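(* Let $k$ be a field of characteristic zero. Consider the commutative algebra $S(T_1)$ on rooted trees as a Hopf algebra with the coproduct $\Delta$ for which every tree is primitive, i.e. $\Delta(s)=s\otimes1+1\otimes s$ for every tree $s$. \begin{enumerate} \item[(i)] The boundaries in $\mathrm{Der}_0(S(T_1),S(T_1)^{\otimes2})$ are the derivations $\phi$ that can be written as \[ \phi(s)=\sum_w c_{s,w}\,\bar\Delta(w) \] for all trees $s$, with constants $c_{s,w}\in k$, where the sum ranges over all forests $w$ such that $|s|=|w|$, and $\bar\Delta=\Delta-(\mathrm{id}\otimes1+1\otimes\mathrm{id})$. \item[(ii)] Let $q_1,q_2,q_1',q_2'\in\hbar\, k[[\hbar]]$ with $q_1\equiv c_1\hbar$, $q_2\equiv c_2\hbar$, $q_1'\equiv d_1\hbar$, $q_2'\equiv d_2\hbar$ modulo $\hbar^2$, where $c_1,c_2,d_1,d_2\in k$. The two graded coalgebra deformations $\Delta_{q_1,q_2}$ and $\Delta_{q_1',q_2'}$ are equivalent modulo $\hbar^2$ if and only if $c_1-c_2=d_1-d_2$. \end{enumerate}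
   Context: A rooted tree is an isomorphism class of finite posets which have a minimum element (the root), and in which $y\neq z$, $y<x$, $z<x$ imply $y<z$ or $z<y$; its elements are called vertices. $T_1$ is the $k$-vector space with basis the rooted trees. A forest is a finite, possibly empty, multiset of trees. $S(T_1)$ has as basis the forests, with product the disjoint union and unit the empty forest; it is graded by the number $|f|$ of vertices. $\lambda:S(T_1)\to S(T_1)$ is the linear map sending a forest to the tree obtained by adding a new root connected by an edge to the root of each tree of the forest. For a Hopf algebra $A$, $\mathrm{Der}(A,A^{\otimes q})$ is the space of algebra derivations $A\to A^{\otimes q}$, where $A^{\otimes q}$ is an $A$-bimodule via the iterated coproduct; these form a subcomplex $\mathrm{Der}(A,A^{\otimes *})$ of the coalgebra Hochschild complex, whose differential in lowest degree is $d\psi=(\psi\otimes\mathrm{id}+\mathrm{id}\otimes\psi)\circ\Delta-\Delta\circ\psi$ for $\psi\in\mathrm{Der}(A,A)$. $\mathrm{Der}_0(S(T_1),S(T_1)^{\otimes *})$ is the subcomplex of derivations preserving the degree. The boundaries in $\mathrm{Der}_0(S(T_1),S(T_1)^{\otimes 2})$ are the elements $d\psi$ with $\psi\in\mathrm{Der}_0(S(T_1),S(T_1))$. A formal coalgebra deformation of a Hopf algebra $A$ is a $k[[\hbar]]$-linear map $\Delta_\hbar:A[[\hbar]]\to A[[\hbar]]\otimes_{k[[\hbar]]}A[[\hbar]]$ which, with the same multiplication and counit, makes $A[[\hbar]]$ a Hopf algebra over $k[[\hbar]]$, and which gives the original Hopf algebra structure at $\hbar=0$. For $q_1,q_2\in\hbar\,k[[\hbar]]$,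 $\Delta_{q_1,q_2}$ is the graded coalgebra deformation of $S(T_1)$ given by the $k[[\hbar]]$-linear algebra homomorphism inductively determined by \[ \Delta_{q_1,q_2}(\lambda(x))=\sum_{(x)}\lambda(x_1)\otimes q_2^{|x_2|}x_2+q_1^{|x_1|}x_1\otimes\lambda(x_2),\qquad \Delta_{q_1,q_2}(x)=\sum_{(x)}x_1\otimes x_2, \] for forests $x$ (Sweedler notation with homogeneous terms, $q^0=1$). Two graded coalgebra deformations $\Delta_\hbar,\Delta_\hbar'$ of $S(T_1)$ are equivalent modulo $\hbar^2$ if there is a derivation $\psi\in\mathrm{Der}_0(S(T_1),S(T_1))$ such that $\Psi=\mathrm{id}+\hbar\,\psi$ satisfies $\Delta_\hbar'\circ\Psi\equiv(\Psi\otimes\Psi)\circ\Delta_\hbar$ modulo $\hbar^2$. *)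

theory Defs
  imports
    "HOL-Library.Poly_Mapping"
    "HOL-Library.Product_Plus"
    "HOL-Library.Sublist"
    "HOL-Library.Disjoint_Sets"
    "HOL-Computational_Algebra.Formal_Power_Series"
begin

section \<open>Rooted trees and forests\<close>

(* Node F adds a new root below the roots of the trees in the forest F. Rooted trees up to
   isomorphism, i.e. isomorphism classes of finite posets with a minimum in which the elements
   below a given one form a chain, are the elements of rtree: see ex1_has_shape,
   has_shape_eq_iff_iso, ex_poset_has_shape and has_shape_card below. *)
datatype rtree = Node "rtree multiset"

type_synonym forest = "rtree multiset"

primrec vertices :: "rtree \<Rightarrow> nat" where
  "vertices (Node F) = Suc (sum_mset (image_mset vertices F))"

definition forest_deg :: "forest \<Rightarrow> nat" where
  "forest_deg w = sum_mset (image_mset vertices w)"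

definition forest2_deg :: "forest \<times> forest \<Rightarrow> nat" where
  "forest2_deg = (\<lambda>(x, y). forest_deg x + forest_deg y)"

subsection \<open>Comparison with isomorphism classes of finite posets\<close>

definition rooted_poset :: "'a set \<Rightarrow> 'a rel \<Rightarrow> bool" where
  "rooted_poset V R \<longleftrightarrow> finite V \<and> partial_order_on V R \<and> (\<exists>r\<in>V. \<forall>x\<in>V. (r, x) \<in> R) \<and>
     (\<forall>x\<in>V. \<forall>y\<in>V. \<forall>z\<in>V. y \<noteq> z \<and> y \<noteq> x \<and> (y, x) \<in> R \<and> z \<noteq> x \<and> (z, x) \<in> R
        \<longrightarrow> (y, z) \<in> R \<or> (z, y) \<in> R)"

definition poset_iso :: "('a \<Rightarrow> 'b) \<Rightarrow> 'a set \<Rightarrow> 'a rel \<Rightarrow> 'b set \<Rightarrow> 'b rel \<Rightarrow> bool" where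
  "poset_iso h V R W S \<longleftrightarrow>
     bij_betw h V W \<and> (\<forall>x\<in>V. \<forall>y\<in>V. (x, y) \<in> R \<longleftrightarrow> (h x, h y) \<in> S)"

definition covers :: "'a set \<Rightarrow> 'a rel \<Rightarrow> 'a \<Rightarrow> 'a set" where
  "covers V R x = {y \<in> V. y \<noteq> x \<and> (x, y) \<in> R \<and>
     (\<forall>z\<in>V. (x, z) \<in> R \<and> (z, y) \<in> R \<longrightarrow> z = x \<or> z = y)}"

(* Labels each vertex x by the tree formed by the elements above x. *)
definition labelling :: "'a set \<Rightarrow> 'a rel \<Rightarrow> ('a \<Rightarrow> rtree) \<Rightarrow> bool" where
  "labelling V R f \<longleftrightarrow> (\<forall>x\<in>V. f x = Node (image_mset f (mset_set (covers V R x))))"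

definition has_shape :: "'a set \<Rightarrow> 'a rel \<Rightarrow> rtree \<Rightarrow> bool" where
  "has_shape V R t \<longleftrightarrow> (\<exists>f r. r \<in> V \<and> (\<forall>x\<in>V. (r, x) \<in> R) \<and> labelling V R f \<and> f r = t)"

definition up :: "'a set \<Rightarrow> 'a rel \<Rightarrow> 'a \<Rightarrow> 'a set" where
  "up V R x = {y \<in> V. (x, y) \<in> R}"

lemma rooted_posetD:
  assumes "rooted_poset V R"
  shows "finite V" "\<And>x. x \<in> V \<Longrightarrow> (x, x) \<in> R"
    "\<And>x y. (x, y) \<in> R \<Longrightarrow> (y, x) \<in> R \<Longrightarrow> x = y"
    "\<And>x y z. (x, y) \<in> R \<Longrightarrow> (y, z) \<in> R \<Longrightarrow> (x, z) \<in> R"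
    "\<And>x y z. x \<in> V \<Longrightarrow> y \<in> V \<Longrightarrow> z \<in> V \<Longrightarrow> (y, x) \<in> R \<Longrightarrow> (z, x) \<in> R
       \<Longrightarrow> (y, z) \<in> R \<or> (z, y) \<in> R"
proof -
  have po: "finite V" "refl_on V R" "antisym R" "trans R"
    using assms by (auto simp: rooted_poset_def partial_order_on_def preorder_on_def)
  show "finite V" by (rule po)
  show refl: "(x, x) \<in> R" if "x \<in> V" for x using po(2) that by (auto simp: refl_on_def)
  show "x = y" if "(x, y) \<in> R" "(y, x) \<in> R" for x y using po(3) that by (rule antisymD)
  show "(x, z) \<in> R" if "(x, y) \<in> R" "(y, z) \<in> R" for x y z using po(4) that by (rule transD)
  show "(y, z) \<in> R \<or> (z, y) \<in> R"
    if "x \<in> V" "y \<in> V" "z \<in> V" "(y, x) \<in> R" "(z, x) \<in> R" for x y z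
  proof (cases "y = z \<or> y = x \<or> z = x")
    case True
    then show ?thesis using that refl by auto
  next
    case False
    then show ?thesis using assms that unfolding rooted_poset_def by blast
  qed
qed

lemma covers_sub: "covers V R x \<subseteq> V"
  by (auto simp: covers_def)

lemma finite_covers: "rooted_poset V R \<Longrightarrow> finite (covers V R x)"
  using covers_sub rooted_posetD(1) finite_subset by metis

lemma finite_up: "rooted_poset V R \<Longrightarrow> finite (up V R x)"
  by (rule finite_subset[of _ V]) (auto simp: up_def rooted_posetD(1))

lemma up_covers_psubset:
  assumes P: "rooted_poset V R" and "x \<in> V" "c \<in> covers V R x"
  shows "up V R c \<subseteq> up V R x" "x \<notin> up V R c"
proof -
  have c: "(x, c) \<in> R" "c \<noteq> x" using assms(3) by (auto simp: covers_def)
  show "up V R c \<subseteq> up V R x" using rooted_posetD(4)[OF P c(1)] by (auto simp: up_def)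
  show "x \<notin> up V R c" using rooted_posetD(3)[OF P c(1)] c(2) by (auto simp: up_def)
qed

lemma card_up_covers:
  assumes P: "rooted_poset V R" and "x \<in> V" "c \<in> covers V R x"
  shows "card (up V R c) < card (up V R x)"
proof (rule psubset_card_mono[OF finite_up[OF P]])
  have "x \<in> up V R x" using assms(2) rooted_posetD(2)[OF P] by (auto simp: up_def)
  then show "up V R c \<subset> up V R x" using up_covers_psubset[OF assms] by auto
qed

lemma up_eq:
  assumes P: "rooted_poset V R" and x: "x \<in> V"
  shows "up V R x = insert x (\<Union>c\<in>covers V R x. up V R c)"
proof
  show "insert x (\<Union>c\<in>covers V R x. up V R c) \<subseteq> up V R x"
    using up_covers_psubset(1)[OF P x] x rooted_posetD(2)[OF P] by (auto simp: up_def)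
  show "up V R x \<subseteq> insert x (\<Union>c\<in>covers V R x. up V R c)"
  proof
    fix y assume y: "y \<in> up V R x"
    show "y \<in> insert x (\<Union>c\<in>covers V R x. up V R c)"
    proof (cases "y = x")
      case False
      define B where "B = {z \<in> V. z \<noteq> x \<and> (x, z) \<in> R \<and> (z, y) \<in> R}"
      have yB: "y \<in> B" using y False rooted_posetD(2)[OF P] by (auto simp: B_def up_def)
      have "finite B" using rooted_posetD(1)[OF P] by (auto simp: B_def)
      then have fin: "finite ((\<lambda>b. card (up V R b)) ` B)" by simp
      then have "Max ((\<lambda>b. card (up V R b)) ` B) \<in> (\<lambda>b. card (up V R b)) ` B"
        using yB by (intro Max_in) auto
      then obtain c where c: "c \<in> B" and
        m: "\<And>b. b \<in> B \<Longrightarrow> card (up V R b) \<le> card (up V R c)"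
        using Max_ge[OF fin] by auto
      have "c \<in> covers V R x"
        unfolding covers_def
      proof (safe)
        show "c \<in> V" "(x, c) \<in> R" using c by (auto simp: B_def)
        show False if "c = x" using c that by (auto simp: B_def)
        fix z assume z: "z \<in> V" "(x, z) \<in> R" "(z, c) \<in> R" "z \<noteq> c"
        show "z = x"
        proof (rule ccontr)
          assume "z \<noteq> x"
          then have "z \<in> B" using z c rooted_posetD(4)[OF P, of z c y] by (auto simp: B_def)
          moreover have "up V R c \<subset> up V R z"
            using z rooted_posetD(2,3,4)[OF P] unfolding up_def by blast
          ultimately show False
            using m[of z] psubset_card_mono[OF finite_up[OF P], of "up V R c" z] by simp
        qed
      qed
      then show ?thesis using c y by (auto simp: B_def up_def)
    qed auto
  qed
qed

lemma up_disjoint: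
  assumes P: "rooted_poset V R" and "c \<in> covers V R x" "d \<in> covers V R x" "c \<noteq> d"
  shows "up V R c \<inter> up V R d = {}"
proof (rule ccontr)
  assume "up V R c \<inter> up V R d \<noteq> {}"
  then obtain y where "y \<in> V" "(c, y) \<in> R" "(d, y) \<in> R" by (auto simp: up_def)
  moreover have "c \<in> V" "d \<in> V" using assms by (auto simp: covers_def)
  ultimately have "(c, d) \<in> R \<or> (d, c) \<in> R" using rooted_posetD(5)[OF P] by blast
  then show False using assms(2-4) unfolding covers_def by auto
qed

lemma labelling_exists:
  assumes P: "rooted_poset V R"
  shows "\<exists>f. labelling V R f"
proof -
  define lab :: "nat \<Rightarrow> 'a \<Rightarrow> rtree" where
    "lab = rec_nat (\<lambda>_. Node {#}) (\<lambda>n g x. Node (image_mset g (mset_set (covers V R x))))"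
  have labS: "lab (Suc n) x = Node (image_mset (lab n) (mset_set (covers V R x)))" for n x
    by (simp add: lab_def)
  have pos: "card (up V R x) > 0" if "x \<in> V" for x
    using that rooted_posetD(2)[OF P] finite_up[OF P] by (auto simp: card_gt_0_iff up_def)
  have eq: "lab n x = lab m x" if "x \<in> V" "card (up V R x) \<le> n" "card (up V R x) \<le> m" for n m x
    using that
  proof (induction n arbitrary: m x)
    case 0
    then show ?case using pos[of x] by simp
  next
    case (Suc n)
    then obtain m' where m: "m = Suc m'" using pos[of x] by (cases m) auto
    have "lab n c = lab m' c" if c: "c \<in> covers V R x" for c
      using card_up_covers[OF P Suc.prems(1) c] Suc.prems covers_sub[of V R x] c m
      by (intro Suc.IH) auto
    then have "image_mset (lab n) (mset_set (covers V R x)) =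
        image_mset (lab m') (mset_set (covers V R x))"
      by (intro image_mset_cong) (simp add: finite_covers[OF P])
    then show ?case by (simp add: m labS)
  qed
  define f where "f x = lab (card (up V R x)) x" for x
  have "f x = Node (image_mset f (mset_set (covers V R x)))" if x: "x \<in> V" for x
  proof -
    obtain k where k: "card (up V R x) = Suc k" using pos[OF x] by (cases "card (up V R x)") auto
    have "lab k c = f c" if c: "c \<in> covers V R x" for c
      unfolding f_def using card_up_covers[OF P x c] covers_sub[of V R x] c k
      by (intro eq) auto
    then have "image_mset (lab k) (mset_set (covers V R x)) =
        image_mset f (mset_set (covers V R x))"
      by (intro image_mset_cong) (simp add: finite_covers[OF P])
    then show ?thesis by (simp add: f_def[of x] k labS)
  qed
  then show ?thesis by (auto simp: labelling_def)
qed

lemma labelling_unique: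
  assumes P: "rooted_poset V R" and f: "labelling V R f" and g: "labelling V R g" and "x \<in> V"
  shows "f x = g x"
  using \<open>x \<in> V\<close>
proof (induction "card (up V R x)" arbitrary: x rule: less_induct)
  case less
  have "image_mset f (mset_set (covers V R x)) = image_mset g (mset_set (covers V R x))"
    using less card_up_covers[OF P less.prems] covers_sub[of V R x]
    by (intro image_mset_cong) (auto simp: finite_covers[OF P])
  then show ?case using f g less.prems by (simp add: labelling_def)
qed

lemma has_shape_unique:
  assumes P: "rooted_poset V R" and "has_shape V R t" "has_shape V R u"
  shows "t = u"
proof -
  obtain f r where r: "r \<in> V" "\<forall>x\<in>V. (r, x) \<in> R" "labelling V R f" "f r = t"
    using assms(2) unfolding has_shape_def by auto
  obtain g s where s: "s \<in> V" "\<forall>x\<in>V. (s, x) \<in> R" "labelling V R g" "g s = u"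
    using assms(3) unfolding has_shape_def by auto
  have "r = s" using rooted_posetD(3)[OF P] r s by blast
  then show ?thesis using labelling_unique[OF P r(3) s(3) r(1)] r s by simp
qed

theorem ex1_has_shape:
  assumes P: "rooted_poset V R"
  shows "\<exists>!t. has_shape V R t"
proof -
  obtain f where "labelling V R f" using labelling_exists[OF P] by auto
  moreover obtain r where "r \<in> V" "\<forall>x\<in>V. (r, x) \<in> R" using P by (auto simp: rooted_poset_def)
  ultimately have "has_shape V R (f r)" unfolding has_shape_def by metis
  then show ?thesis using has_shape_unique[OF P] by blast
qed

lemma card_up:
  assumes P: "rooted_poset V R" and f: "labelling V R f" and "x \<in> V"
  shows "card (up V R x) = vertices (f x)"
  using \<open>x \<in> V\<close>
proof (induction "card (up V R x)" arbitrary: x rule: less_induct)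
  case less
  have "card (up V R x) = Suc (card (\<Union>c\<in>covers V R x. up V R c))"
    unfolding up_eq[OF P less.prems]
    using up_covers_psubset(2)[OF P less.prems] finite_covers[OF P] finite_up[OF P] by simp
  also have "card (\<Union>c\<in>covers V R x. up V R c) = (\<Sum>c\<in>covers V R x. card (up V R c))"
    using finite_covers[OF P] finite_up[OF P] up_disjoint[OF P] by (intro card_UN_disjoint) auto
  also have "\<dots> = (\<Sum>c\<in>covers V R x. vertices (f c))"
    using less card_up_covers[OF P less.prems] covers_sub[of V R x] by (intro sum.cong) auto
  also have "Suc \<dots> = vertices (f x)"
    using f less.prems unfolding labelling_def
    by (simp add: sum_unfold_sum_mset image_mset.compositionality comp_def)
  finally show ?case .
qed

theorem has_shape_card:
  assumes P: "rooted_poset V R" and "has_shape V R t"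
  shows "card V = vertices t"
proof -
  obtain f r where r: "r \<in> V" "\<forall>x\<in>V. (r, x) \<in> R" "labelling V R f" "f r = t"
    using assms(2) unfolding has_shape_def by auto
  then have "up V R r = V" by (auto simp: up_def)
  then show ?thesis using card_up[OF P r(3,1)] r(4) by simp
qed

lemma image_mset_eq_bij:
  assumes "finite A" "finite B" "image_mset f (mset_set A) = image_mset g (mset_set B)"
  shows "\<exists>k. bij_betw k A B \<and> (\<forall>a\<in>A. f a = g (k a))"
  using assms
proof (induction A arbitrary: B rule: finite_induct)
  case empty
  then have "B = {}" by (auto simp: mset_set_empty_iff)
  then show ?case by (simp add: bij_betw_def)
next
  case (insert a A)
  have "f a \<in># image_mset g (mset_set B)"
    using insert.hyps insert.prems(2) by (metis finite_insert finite_set_mset_mset_set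
        imageI insertI1 set_image_mset)
  then obtain b where b: "b \<in> B" "f a = g b" using insert.prems(1) by auto
  have "mset_set B = add_mset b (mset_set (B - {b}))"
    using b insert.prems(1) by (simp add: mset_set.remove)
  then have "image_mset f (mset_set A) = image_mset g (mset_set (B - {b}))"
    using insert.hyps insert.prems(2) b by simp
  then obtain k where k: "bij_betw k A (B - {b})" "\<forall>x\<in>A. f x = g (k x)"
    using insert.IH[of "B - {b}"] insert.prems(1) by auto
  have "bij_betw (k(a := b)) (insert a A) B"
  proof -
    have "bij_betw (k(a := b)) A (B - {b})"
      using k(1) insert.hyps by (subst bij_betw_cong[of _ _ k]) auto
    from notIn_Un_bij_betw[OF insert.hyps(2) _ this] show ?thesis
      using b(1) by (simp add: insert_absorb)
  qed
  moreover have "\<forall>x\<in>insert a A. f x = g ((k(a := b)) x)"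
    using k(2) b(2) insert.hyps by auto
  ultimately show ?case by blast
qed

lemma same_label_iso:
  assumes P: "rooted_poset V R" and Q: "rooted_poset W S"
    and f: "labelling V R f" and g: "labelling W S g"
  shows "x \<in> V \<Longrightarrow> y \<in> W \<Longrightarrow> f x = t \<Longrightarrow> g y = t \<Longrightarrow> \<exists>h. poset_iso h (up V R x) R (up W S y) S"
proof (induction t arbitrary: x y)
  case (Node F)
  define C where "C = covers V R x"
  define D where "D = covers W S y"
  have fin: "finite C" "finite D" using finite_covers P Q by (auto simp: C_def D_def)
  have FC: "image_mset f (mset_set C) = F" and FD: "image_mset g (mset_set D) = F"
    using f g Node.prems by (auto simp: labelling_def C_def D_def)
  obtain k where k: "bij_betw k C D" "\<forall>c\<in>C. f c = g (k c)"
    using image_mset_eq_bij[OF fin] FC FD by metis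
  have "\<exists>h. poset_iso h (up V R c) R (up W S (k c)) S" if c: "c \<in> C" for c
  proof (rule Node.IH[of "f c"])
    show "f c \<in> set_mset F" using c fin FC by auto
    show "c \<in> V" using c by (auto simp: C_def covers_def)
    have "k c \<in> D" using c k(1) by (auto simp: bij_betw_def)
    then show "k c \<in> W" by (auto simp: D_def covers_def)
  qed (use c k(2) in auto)
  then obtain H where H: "\<And>c. c \<in> C \<Longrightarrow> poset_iso (H c) (up V R c) R (up W S (k c)) S"
    by metis
  define h where "h p = (if p = x then y else H (THE c. c \<in> C \<and> p \<in> up V R c) p)" for p
  have hc: "h p = H c p" if "c \<in> C" "p \<in> up V R c" for c p
  proof -
    have "(THE c. c \<in> C \<and> p \<in> up V R c) = c"
      using that up_disjoint[OF P] by (intro the_equality) (auto simp: C_def)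
    moreover have "p \<noteq> x" using that up_covers_psubset(2)[OF P Node.prems(1)] by (auto simp: C_def)
    ultimately show ?thesis by (simp add: h_def)
  qed
  have bc: "bij_betw h (up V R c) (up W S (k c))" if "c \<in> C" for c
    using H[OF that] hc[OF that] bij_betw_cong[of "up V R c" h "H c"] by (auto simp: poset_iso_def)
  have kD: "k c \<in> D" if "c \<in> C" for c using that k(1) by (auto simp: bij_betw_def)
  have kinj: "k c \<noteq> k c'" if "c \<in> C" "c' \<in> C" "c \<noteq> c'" for c c'
    using that k(1) by (auto simp: bij_betw_def inj_on_def)
  have disj: "up W S (k c) \<inter> up W S (k c') = {}" if "c \<in> C" "c' \<in> C" "c \<noteq> c'" for c c'
    using up_disjoint[OF Q] kD kinj that by (metis D_def)
  have "bij_betw h (\<Union>c\<in>C. up V R c) (\<Union>c\<in>C. up W S (k c))"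
    by (rule bij_betw_UNION_disjoint) (use disj bc in \<open>auto simp: disjoint_family_on_def\<close>)
  moreover have "(\<Union>c\<in>C. up W S (k c)) = (\<Union>d\<in>D. up W S d)"
    using k(1) by (auto simp: bij_betw_def)
  ultimately have B: "bij_betw h (\<Union>c\<in>C. up V R c) (\<Union>d\<in>D. up W S d)" by simp
  have hx: "h x = y" by (simp add: h_def)
  have "bij_betw h (insert x (\<Union>c\<in>C. up V R c)) (insert y (\<Union>d\<in>D. up W S d))"
    using notIn_Un_bij_betw[of x "\<Union>c\<in>C. up V R c" h "\<Union>d\<in>D. up W S d"] B hx
      up_covers_psubset(2)[OF P Node.prems(1)] up_covers_psubset(2)[OF Q Node.prems(2)]
    by (auto simp: C_def D_def)
  then have bij: "bij_betw h (up V R x) (up W S y)"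
    using up_eq[OF P Node.prems(1)] up_eq[OF Q Node.prems(2)] by (simp add: C_def D_def)
  have "(p, q) \<in> R \<longleftrightarrow> (h p, h q) \<in> S" if p: "p \<in> up V R x" and q: "q \<in> up V R x" for p q
  proof -
    have hp: "h p \<in> up W S y" and hq: "h q \<in> up W S y"
      using bij p q by (auto simp: bij_betw_def)
    have inj: "h p = h q \<longleftrightarrow> p = q" using bij p q by (auto simp: bij_betw_def inj_on_def)
    have xin: "x \<in> up V R x" using Node.prems(1) rooted_posetD(2)[OF P] by (auto simp: up_def)
    consider "p = x" | "p \<noteq> x" "q = x" | "p \<noteq> x" "q \<noteq> x" by blast
    then show ?thesis
    proof cases
      case 1
      then show ?thesis using q hq hx by (auto simp: up_def)
    next
      case 2
      have "(p, q) \<notin> R" using 2 p rooted_posetD(3)[OF P] by (auto simp: up_def)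
      moreover have "(h p, y) \<notin> S"
        using 2 inj hx hp rooted_posetD(3)[OF Q, of y "h p"] by (auto simp: up_def)
      ultimately show ?thesis using 2 hx by simp
    next
      case 3
      then obtain c d where c: "c \<in> C" "p \<in> up V R c" and d: "d \<in> C" "q \<in> up V R d"
        using p q up_eq[OF P Node.prems(1)] by (auto simp: C_def)
      have hpc: "h p \<in> up W S (k c)" and hqd: "h q \<in> up W S (k d)"
        using bc c d by (auto simp: bij_betw_def)
      show ?thesis
      proof (cases "c = d")
        case True
        then show ?thesis using H[OF c(1)] c d hc by (auto simp: poset_iso_def)
      next
        case False
        have "(p, q) \<notin> R"
        proof
          assume "(p, q) \<in> R"
          then have "q \<in> up V R c" using c d rooted_posetD(4)[OF P, of c p q] by (auto simp: up_def)
          then show False using up_disjoint[OF P, of c x d] c d False by (auto simp: C_def)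
        qed
        moreover have "(h p, h q) \<notin> S"
        proof
          assume "(h p, h q) \<in> S"
          then have "h q \<in> up W S (k c)"
            using hpc hqd rooted_posetD(4)[OF Q, of "k c" "h p" "h q"] by (auto simp: up_def)
          then show False using disj[OF c(1) d(1) False] hqd by auto
        qed
        ultimately show ?thesis by simp
      qed
    qed
  qed
  then show ?case using bij unfolding poset_iso_def by blast
qed

theorem has_shape_eq_iff_iso:
  assumes P: "rooted_poset V R" and Q: "rooted_poset W S"
    and t: "has_shape V R t" and u: "has_shape W S u"
  shows "t = u \<longleftrightarrow> (\<exists>h. poset_iso h V R W S)"
proof
  obtain f r where r: "r \<in> V" "\<forall>x\<in>V. (r, x) \<in> R" "labelling V R f" "f r = t"
    using t unfolding has_shape_def by auto
  obtain g s where s: "s \<in> W" "\<forall>x\<in>W. (s, x) \<in> S" "labelling W S g" "g s = u"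
    using u unfolding has_shape_def by auto
  have "up V R r = V" "up W S s = W" using r s by (auto simp: up_def)
  then show "\<exists>h. poset_iso h V R W S" if "t = u"
    using same_label_iso[OF P Q r(3) s(3) r(1) s(1)] r(4) s(4) that by metis
  assume "\<exists>h. poset_iso h V R W S"
  then obtain h where h: "bij_betw h V W"
    and iso: "\<And>x y. x \<in> V \<Longrightarrow> y \<in> V \<Longrightarrow> (x, y) \<in> R \<longleftrightarrow> (h x, h y) \<in> S"
    by (auto simp: poset_iso_def)
  have hW: "W = h ` V" and inj: "inj_on h V" using h by (auto simp: bij_betw_def)
  have cov: "covers W S (h x) = h ` covers V R x" if x: "x \<in> V" for x
  proof -
    have eq: "h a = h b \<longleftrightarrow> a = b" if "a \<in> V" "b \<in> V" for a b
      using inj that by (auto simp: inj_on_def)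
    have "covers W S (h x) = h ` {y \<in> V. h y \<noteq> h x \<and> (h x, h y) \<in> S \<and>
        (\<forall>z\<in>V. (h x, h z) \<in> S \<and> (h z, h y) \<in> S \<longrightarrow> h z = h x \<or> h z = h y)}"
    proof -
      have img: "{y \<in> h ` V. P y} = h ` {y \<in> V. P (h y)}" for P by auto
      show ?thesis unfolding covers_def hW img by simp
    qed
    also have "\<dots> = h ` covers V R x"
    proof (rule arg_cong[where f = "image h"], rule set_eqI)
      fix y
      show "y \<in> {y \<in> V. h y \<noteq> h x \<and> (h x, h y) \<in> S \<and>
          (\<forall>z\<in>V. (h x, h z) \<in> S \<and> (h z, h y) \<in> S \<longrightarrow> h z = h x \<or> h z = h y)}
        \<longleftrightarrow> y \<in> covers V R x"
        using x by (cases "y \<in> V") (simp_all add: covers_def eq iso[symmetric])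
    qed
    finally show ?thesis .
  qed
  have "labelling V R (g \<circ> h)"
    unfolding labelling_def
  proof
    fix x assume x: "x \<in> V"
    have "g (h x) = Node (image_mset g (mset_set (h ` covers V R x)))"
      using s(3) x hW cov[OF x] by (auto simp: labelling_def)
    also have "mset_set (h ` covers V R x) = image_mset h (mset_set (covers V R x))"
      using inj_on_subset[OF inj covers_sub] by (simp add: image_mset_mset_set)
    finally show "(g \<circ> h) x = Node (image_mset (g \<circ> h) (mset_set (covers V R x)))"
      by (simp add: image_mset.compositionality)
  qed
  moreover have "h r = s"
  proof (rule rooted_posetD(3)[OF Q])
    show "(s, h r) \<in> S" using s r hW by auto
    obtain r' where "r' \<in> V" "s = h r'" using s(1) hW by auto
    then show "(h r, s) \<in> S" using iso r by auto
  qed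
  ultimately have "has_shape V R u"
    unfolding has_shape_def using r(1,2) s(4) by (intro exI[of _ "g \<circ> h"] exI[of _ r]) simp
  then show "t = u" using has_shape_unique[OF P t] by simp
qed

theorem ex_poset_has_shape:
  "\<exists>(V :: nat list set) R. rooted_poset V R \<and> has_shape V R t"
proof -
  let ?R = "{(p, q). prefix p q} :: nat list rel"
  have "\<exists>V f. finite V \<and> [] \<in> V \<and> labelling V ?R f \<and> f [] = t"
  proof (induction t)
    case (Node F)
    obtain ts where ts: "mset ts = F" using ex_mset by auto
    have "\<exists>V f. finite V \<and> [] \<in> V \<and> labelling V ?R f \<and> f [] = ts ! i" if "i < length ts" for i
      using Node[of "ts ! i"] that ts nth_mem_mset[of i ts] by auto
    then obtain V f where
      V: "\<And>i. i < length ts \<Longrightarrow> finite (V i) \<and> [] \<in> V i \<and> labelling (V i) ?R (f i) \<and> f i [] = ts ! i"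
      by metis
    define U where "U = insert [] (\<Union>i<length ts. (#) i ` V i)"
    define e where "e p = (case p of [] \<Rightarrow> Node F | i # q \<Rightarrow> f i q)" for p
    have cov0: "covers U ?R [] = (\<lambda>i. [i]) ` {..<length ts}"
    proof
      show "covers U ?R [] \<subseteq> (\<lambda>i. [i]) ` {..<length ts}"
      proof
        fix y assume y: "y \<in> covers U ?R []"
        then obtain i q where i: "y = i # q" "i < length ts" by (auto simp: covers_def U_def)
        have "[i] \<in> U" using V i by (auto simp: U_def)
        then have "[i] = y" using y i by (auto simp: covers_def)
        then show "y \<in> (\<lambda>i. [i]) ` {..<length ts}" using i by auto
      qed
      show "(\<lambda>i. [i]) ` {..<length ts} \<subseteq> covers U ?R []"
        using V by (auto simp: covers_def U_def prefix_Cons)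
    qed
    have covS: "covers U ?R (i # p) = (#) i ` covers (V i) ?R p" if "i < length ts" for i p
    proof -
      have U: "i # q \<in> U \<longleftrightarrow> q \<in> V i" for q using that by (auto simp: U_def)
      have cons: "(\<forall>z\<in>U. (i # p, z) \<in> ?R \<and> (z, i # q) \<in> ?R \<longrightarrow> z = i # p \<or> z = i # q)
          \<longleftrightarrow> (\<forall>z\<in>V i. (p, z) \<in> ?R \<and> (z, q) \<in> ?R \<longrightarrow> z = p \<or> z = q)" (is "?l \<longleftrightarrow> ?r") for q
      proof
        assume l: ?l
        show ?r
        proof
          fix z assume "z \<in> V i"
          then have "i # z \<in> U" by (simp add: U)
          from bspec[OF l this] show "(p, z) \<in> ?R \<and> (z, q) \<in> ?R \<longrightarrow> z = p \<or> z = q" by simp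
        qed
      next
        assume r: ?r
        show ?l
        proof
          fix z assume z: "z \<in> U"
          show "(i # p, z) \<in> ?R \<and> (z, i # q) \<in> ?R \<longrightarrow> z = i # p \<or> z = i # q"
          proof (cases z)
            case (Cons j z')
            show ?thesis
            proof (cases "j = i")
              case True
              then have "z' \<in> V i" using z Cons by (simp add: U)
              from bspec[OF r this] show ?thesis using Cons True by simp
            qed (simp add: Cons)
          qed simp
        qed
      qed
      have mem: "i # q \<in> covers U ?R (i # p) \<longleftrightarrow> q \<in> covers (V i) ?R p" for q
        using cons[of q] unfolding covers_def by (simp add: U)
      show ?thesis
      proof (rule set_eqI)
        fix y
        show "y \<in> covers U ?R (i # p) \<longleftrightarrow> y \<in> (#) i ` covers (V i) ?R p"
        proof (cases "\<exists>q. y = i # q")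
          case True
          then show ?thesis using mem by auto
        next
          case False
          then show ?thesis by (cases y) (auto simp: covers_def)
        qed
      qed
    qed
    have "labelling U ?R e"
      unfolding labelling_def
    proof
      fix x assume "x \<in> U"
      then consider "x = []" | i p where "i < length ts" "x = i # p" "p \<in> V i"
        by (auto simp: U_def)
      then show "e x = Node (image_mset e (mset_set (covers U ?R x)))"
      proof cases
        case 1
        have "mset_set ((\<lambda>i. [i]) ` {..<length ts}) = image_mset (\<lambda>i. [i]) (mset_set {..<length ts})"
          by (rule image_mset_mset_set[symmetric]) (auto simp: inj_on_def)
        then have "image_mset e (mset_set (covers U ?R x))
            = image_mset (\<lambda>i. f i []) (mset_set {..<length ts})"
          by (simp add: 1 cov0 image_mset.compositionality comp_def e_def)
        also have "\<dots> = image_mset ((!) ts) (mset_set {..<length ts})"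
          using V by (intro image_mset_cong) auto
        also have "\<dots> = mset (map ((!) ts) [0..<length ts])"
          by (simp add: mset_set_upto_eq_mset_upto lessThan_atLeast0)
        also have "\<dots> = F" using ts by (simp add: map_nth)
        finally show ?thesis by (simp add: 1 e_def)
      next
        case 2
        have "mset_set ((#) i ` covers (V i) ?R p) = image_mset ((#) i) (mset_set (covers (V i) ?R p))"
          by (rule image_mset_mset_set[symmetric]) (auto simp: inj_on_def)
        then have "image_mset e (mset_set (covers U ?R x))
            = image_mset (f i) (mset_set (covers (V i) ?R p))"
          using 2 by (simp add: covS image_mset.compositionality comp_def e_def)
        then show ?thesis using V[OF 2(1)] 2 by (auto simp: labelling_def e_def)
      qed
    qed
    moreover have "finite U" "[] \<in> U" "e [] = Node F" using V by (auto simp: U_def e_def)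
    ultimately show ?case by blast
  qed
  then obtain V f where V: "finite V" "[] \<in> V" "labelling V ?R f" "f [] = t" by blast
  define R where "R = ?R \<inter> V \<times> V"
  have R: "(p, q) \<in> R \<longleftrightarrow> p \<in> V \<and> q \<in> V \<and> prefix p q" for p q by (auto simp: R_def)
  have "partial_order_on V R"
    unfolding partial_order_on_def preorder_on_def
    by (auto simp: R refl_on_def antisym_def trans_def)
  moreover have "\<exists>r\<in>V. \<forall>x\<in>V. (r, x) \<in> R"
    using V(2) by (intro bexI[of _ "[]"]) (auto simp: R)
  moreover have "(y, z) \<in> R \<or> (z, y) \<in> R" if "(y, x) \<in> R" "(z, x) \<in> R" for x y z
    using that prefix_same_cases[of y x z] by (auto simp: R)
  ultimately have "rooted_poset V R"
    unfolding rooted_poset_def using V(1) by blast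
  moreover have "covers V R x = covers V ?R x" if "x \<in> V" for x
    unfolding covers_def by (rule Collect_cong) (use that R in \<open>simp cong: conj_cong\<close>)
  then have "has_shape V R t"
    using V unfolding has_shape_def labelling_def
    by (intro exI[of _ f] exI[of _ "[]"]) (simp add: R)
  ultimately show ?thesis by blast
qed

subsection \<open>Forests of given degree\<close>

lemma vertices_pos: "vertices t > 0"
  by (cases t) auto

lemma finite_forest_deg: "finite {w. forest_deg w = n}"
proof (induction n rule: less_induct)
  case (less n)
  define T where "T = {t. vertices t \<le> n}"
  have "T \<subseteq> (\<Union>m<n. Node ` {w. forest_deg w = m})"
  proof
    fix t assume "t \<in> T"
    then show "t \<in> (\<Union>m<n. Node ` {w. forest_deg w = m})"
      by (cases t) (auto simp: T_def forest_deg_def)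
  qed
  moreover have "finite (\<Union>m<n. Node ` {w. forest_deg w = m})"
    using less by auto
  ultimately have "finite T" by (rule finite_subset)
  then have fin: "finite (mset ` {ts. set ts \<subseteq> T \<and> length ts \<le> n})"
    using finite_lists_length_le by blast
  have "{w. forest_deg w = n} \<subseteq> mset ` {ts. set ts \<subseteq> T \<and> length ts \<le> n}"
  proof
    fix w assume "w \<in> {w. forest_deg w = n}"
    then have w: "forest_deg w = n" by simp
    obtain ts where ts: "w = mset ts" using ex_mset by metis
    have *: "length us \<le> forest_deg (mset us)" for us
    proof (induction us)
      case (Cons u us)
      then show ?case using vertices_pos[of u] by (simp add: forest_deg_def)
    qed simp
    have "vertices t \<le> forest_deg (mset us)" if "t \<in> set us" for t us
      using that by (induction us) (auto simp: forest_deg_def)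
    then have "set ts \<subseteq> T" using w ts by (auto simp: T_def)
    then show "w \<in> mset ` {ts. set ts \<subseteq> T \<and> length ts \<le> n}" using *[of ts] ts w by auto
  qed
  then show ?case using fin by (rule finite_subset)
qed

section \<open>The algebra on rooted trees\<close>

(* Since addition of multisets is disjoint union of forests and pairs are added componentwise,
   the convolution product of Poly_Mapping is the product of S(T_1), respectively of its tensor
   square, whose basis are the pairs of forests. *)
type_synonym 'k forest_alg = "forest \<Rightarrow>\<^sub>0 'k"
type_synonym 'k forest_alg2 = "(forest \<times> forest) \<Rightarrow>\<^sub>0 'k"

definition basis :: "'b \<Rightarrow> 'b \<Rightarrow>\<^sub>0 'k::comm_ring_1" where
  "basis x = Poly_Mapping.single x 1"

definition scl :: "'k::comm_ring_1 \<Rightarrow> ('b::comm_monoid_add \<Rightarrow>\<^sub>0 'k) \<Rightarrow> ('b \<Rightarrow>\<^sub>0 'k)" where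
  "scl c a = Poly_Mapping.single 0 c * a"

definition lin_extend ::
    "('b \<Rightarrow> ('c::comm_monoid_add \<Rightarrow>\<^sub>0 'k)) \<Rightarrow> ('b \<Rightarrow>\<^sub>0 'k::comm_ring_1) \<Rightarrow> ('c \<Rightarrow>\<^sub>0 'k)" where
  "lin_extend f a = (\<Sum>x\<in>Poly_Mapping.keys a. scl (Poly_Mapping.lookup a x) (f x))"

definition tens :: "'k::comm_ring_1 forest_alg \<Rightarrow> 'k forest_alg \<Rightarrow> 'k forest_alg2" where
  "tens a b = (\<Sum>x\<in>Poly_Mapping.keys a. \<Sum>y\<in>Poly_Mapping.keys b.
     Poly_Mapping.single (x, y) (Poly_Mapping.lookup a x * Poly_Mapping.lookup b y))"

definition tens_map ::
    "('k::comm_ring_1 forest_alg \<Rightarrow> 'k forest_alg) \<Rightarrow> ('k forest_alg \<Rightarrow> 'k forest_alg)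
     \<Rightarrow> 'k forest_alg2 \<Rightarrow> 'k forest_alg2" where
  "tens_map f g = lin_extend (\<lambda>(x, y). tens (f (basis x)) (g (basis y)))"

definition tree :: "rtree \<Rightarrow> 'k::comm_ring_1 forest_alg" where
  "tree s = basis {#s#}"

definition coprod :: "'k::comm_ring_1 forest_alg \<Rightarrow> 'k forest_alg2" where
  "coprod = lin_extend (\<lambda>w. \<Prod>s\<in>#w. tens (tree s) 1 + tens 1 (tree s))"

definition coprod_bar :: "'k::comm_ring_1 forest_alg \<Rightarrow> 'k forest_alg2" where
  "coprod_bar a = coprod a - (tens a 1 + tens 1 a)"

section \<open>Derivations and boundaries\<close>

definition homogeneous :: "('b \<Rightarrow> nat) \<Rightarrow> nat \<Rightarrow> ('b \<Rightarrow>\<^sub>0 'k::comm_ring_1) \<Rightarrow> bool" where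
  "homogeneous deg n a \<longleftrightarrow> (\<forall>x\<in>Poly_Mapping.keys a. deg x = n)"

(* Derivations into a bimodule on which an algebra element a acts, on both sides, as
   multiplication by \<rho> a; here \<rho> is the iterated coproduct, which is the identity for
   Der(A, A) and coprod for the tensor square. *)
definition derivations ::
    "('k::field forest_alg \<Rightarrow> ('c::comm_monoid_add \<Rightarrow>\<^sub>0 'k)) \<Rightarrow> ('k forest_alg \<Rightarrow> ('c \<Rightarrow>\<^sub>0 'k)) set"
  where
  "derivations \<rho> = {\<phi>. Vector_Spaces.linear scl scl \<phi> \<and> (\<forall>a b. \<phi> (a * b) = \<phi> a * \<rho> b + \<rho> a * \<phi> b)}"

definition Der0_1 :: "('k::field forest_alg \<Rightarrow> 'k forest_alg) set" where
  "Der0_1 = {\<psi> \<in> derivations (\<lambda>a. a).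
     \<forall>n a. homogeneous forest_deg n a \<longrightarrow> homogeneous forest_deg n (\<psi> a)}"

definition Der0_2 :: "('k::field forest_alg \<Rightarrow> 'k forest_alg2) set" where
  "Der0_2 = {\<phi> \<in> derivations coprod.
     \<forall>n a. homogeneous forest_deg n a \<longrightarrow> homogeneous forest2_deg n (\<phi> a)}"

definition hochschild_d ::
    "('k::comm_ring_1 forest_alg \<Rightarrow> 'k forest_alg) \<Rightarrow> 'k forest_alg \<Rightarrow> 'k forest_alg2" where
  "hochschild_d \<psi> a = tens_map \<psi> id (coprod a) + tens_map id \<psi> (coprod a) - coprod (\<psi> a)"

definition boundaries0_2 :: "('k::field forest_alg \<Rightarrow> 'k forest_alg2) set" where
  "boundaries0_2 = hochschild_d ` Der0_1"

section \<open>Formal deformations\<close>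

(* A[[h]] is the type of power series over A, and the (h-adically completed) tensor product
   of A[[h]] with itself over k[[h]] is the type of power series over the tensor square of A. *)

definition emb :: "'k::comm_ring_1 fps \<Rightarrow> ('b::comm_monoid_add \<Rightarrow>\<^sub>0 'k) fps" where
  "emb q = Abs_fps (\<lambda>n. Poly_Mapping.single 0 (fps_nth q n))"

definition hscl :: "'k::comm_ring_1 fps \<Rightarrow> ('b::comm_monoid_add \<Rightarrow>\<^sub>0 'k) fps \<Rightarrow> ('b \<Rightarrow>\<^sub>0 'k) fps" where
  "hscl q F = emb q * F"

(* The unique k[[h]]-linear map that sends each basis element x to f x. *)
definition h_extend ::
    "('b \<Rightarrow> ('c::comm_monoid_add \<Rightarrow>\<^sub>0 'k) fps) \<Rightarrow> ('b \<Rightarrow>\<^sub>0 'k::comm_ring_1) fps \<Rightarrow> ('c \<Rightarrow>\<^sub>0 'k) fps"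
  where
  "h_extend f F =
     Abs_fps (\<lambda>n. \<Sum>i=0..n. lin_extend (\<lambda>x. fps_nth (f x) (n - i)) (fps_nth F i))"

definition h_tens ::
    "'k::comm_ring_1 forest_alg fps \<Rightarrow> 'k forest_alg fps \<Rightarrow> 'k forest_alg2 fps" where
  "h_tens F G = Abs_fps (\<lambda>n. \<Sum>i=0..n. tens (fps_nth F i) (fps_nth G (n - i)))"

definition h_tens_map ::
    "('k::comm_ring_1 forest_alg fps \<Rightarrow> 'k forest_alg fps)
     \<Rightarrow> ('k forest_alg fps \<Rightarrow> 'k forest_alg fps) \<Rightarrow> 'k forest_alg2 fps \<Rightarrow> 'k forest_alg2 fps" where
  "h_tens_map \<Phi> \<Psi> =
     h_extend (\<lambda>(x, y). h_tens (\<Phi> (fps_const (basis x))) (\<Psi> (fps_const (basis y))))"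

(* Sends x (x) y to \<lambda>(x) (x) q2^|y| y + q1^|x| x (x) \<lambda>(y), for forests x and y. *)
definition graft_step ::
    "'k::comm_ring_1 fps \<Rightarrow> 'k fps \<Rightarrow> 'k forest_alg2 fps \<Rightarrow> 'k forest_alg2 fps" where
  "graft_step q1 q2 = h_extend (\<lambda>(x, y).
     hscl (q2 ^ forest_deg y) (fps_const (tens (tree (Node x)) (basis y)))
     + hscl (q1 ^ forest_deg x) (fps_const (tens (basis x) (tree (Node y)))))"

primrec coprod_q_tree :: "'k::comm_ring_1 fps \<Rightarrow> 'k fps \<Rightarrow> rtree \<Rightarrow> 'k forest_alg2 fps" where
  "coprod_q_tree q1 q2 (Node x) =
     graft_step q1 q2 (prod_mset (image_mset (coprod_q_tree q1 q2) x))"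

definition coprod_q ::
    "'k::comm_ring_1 fps \<Rightarrow> 'k fps \<Rightarrow> 'k forest_alg fps \<Rightarrow> 'k forest_alg2 fps" where
  "coprod_q q1 q2 = h_extend (\<lambda>w. \<Prod>s\<in>#w. coprod_q_tree q1 q2 s)"

definition cong_h2 :: "'a::comm_ring_1 fps \<Rightarrow> 'a fps \<Rightarrow> bool" where
  "cong_h2 F G \<longleftrightarrow> fps_X ^ 2 dvd F - G"

definition id_plus_h ::
    "('k::comm_ring_1 forest_alg \<Rightarrow> 'k forest_alg) \<Rightarrow> 'k forest_alg fps \<Rightarrow> 'k forest_alg fps" where
  "id_plus_h \<psi> F = F + fps_X * Abs_fps (\<lambda>n. \<psi> (fps_nth F n))"

definition equivalent_mod_h2 ::
    "('k::field forest_alg fps \<Rightarrow> 'k forest_alg2 fps) \<Rightarrow> ('k forest_alg fps \<Rightarrow> 'k forest_alg2 fps)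
     \<Rightarrow> bool" where
  "equivalent_mod_h2 D D' \<longleftrightarrow> (\<exists>\<psi>\<in>Der0_1. \<forall>F.
     cong_h2 (D' (id_plus_h \<psi> F)) (h_tens_map (id_plus_h \<psi>) (id_plus_h \<psi>) (D F)))"

section \<open>The defining properties of the coproducts\<close>

lemma scl_add: "scl c (a + b) = scl c a + scl c b"
  by (simp add: scl_def algebra_simps)

lemma scl_add_left: "scl (c + d) a = scl c a + scl d a"
  by (simp add: scl_def single_add algebra_simps)

lemma scl_scl: "scl c (scl d a) = scl (c * d) a"
  by (simp add: scl_def mult_single mult.assoc[symmetric])

lemma scl_one: "scl 1 a = a"
  by (simp add: scl_def)

lemma scl_zero: "scl 0 a = 0" "scl c 0 = 0"
  by (simp_all add: scl_def)

lemma scl_sum: "scl c (\<Sum>i\<in>I. g i) = (\<Sum>i\<in>I. scl c (g i))"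
  by (simp add: scl_def sum_distrib_left)

lemma scl_mult: "scl c a * b = scl c (a * b)" "a * scl c b = scl c (a * b)"
  by (simp_all add: scl_def ac_simps)

lemma lookup_scl: "Poly_Mapping.lookup (scl c a) x = c * Poly_Mapping.lookup a x"
  unfolding scl_def mult_map_scale_conv_mult[symmetric] by (simp add: map.rep_eq when_def)

lemma basis_zero: "basis 0 = 1"
  by (simp add: basis_def)

lemma basis_mult: "basis (x + y) = basis x * basis y"
  by (simp add: basis_def mult_single)

lemma lin_extend_superset:
  assumes "finite K" "Poly_Mapping.keys a \<subseteq> K"
  shows "lin_extend f a = (\<Sum>x\<in>K. scl (Poly_Mapping.lookup a x) (f x))"
  unfolding lin_extend_def using assms
  by (intro sum.mono_neutral_left) (auto simp: in_keys_iff scl_zero)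

lemma lin_extend_basis: "lin_extend f (basis x) = f x"
  by (simp add: lin_extend_def basis_def scl_one)

lemma lin_extend_zero: "lin_extend f 0 = 0"
  by (simp add: lin_extend_def)

lemma lin_extend_add: "lin_extend f (a + b) = lin_extend f a + lin_extend f b"
proof -
  let ?K = "Poly_Mapping.keys a \<union> Poly_Mapping.keys b"
  have "Poly_Mapping.keys (a + b) \<subseteq> ?K" by (rule keys_add)
  then show ?thesis
    by (simp add: lin_extend_superset[of ?K] lookup_add scl_add_left sum.distrib)
qed

lemma lin_extend_scl: "lin_extend f (scl c a) = scl c (lin_extend f a)"
proof -
  have "Poly_Mapping.keys (scl c a) \<subseteq> Poly_Mapping.keys a" by (auto simp: in_keys_iff lookup_scl)
  then show ?thesis
    by (simp add: lin_extend_superset[of "Poly_Mapping.keys a"] lookup_scl scl_sum scl_scl)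
qed

lemma lin_extend_sum: "lin_extend f (\<Sum>i\<in>I. g i) = (\<Sum>i\<in>I. lin_extend f (g i))"
  by (induction I rule: infinite_finite_induct) (auto simp: lin_extend_zero lin_extend_add)

lemma basis_expansion: "a = (\<Sum>x\<in>Poly_Mapping.keys a. scl (Poly_Mapping.lookup a x) (basis x))"
  by (rule poly_mapping_eqI)
    (auto simp: lookup_sum lookup_scl basis_def lookup_single when_def in_keys_iff
      if_distrib[of "(*) _"] sum.delta cong: if_cong)

lemma emb_add: "emb (p + q) = emb p + emb q"
  by (simp add: emb_def fps_eq_iff single_add)

lemma emb_one: "emb 1 = 1"
  by (auto simp: emb_def fps_eq_iff)

lemma single0_sum: "Poly_Mapping.single 0 (\<Sum>i\<in>I. g i) = (\<Sum>i\<in>I. Poly_Mapping.single 0 (g i))"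
  by (induction I rule: infinite_finite_induct) (auto simp: single_add)

lemma emb_mult: "emb (p * q) = emb p * emb q"
  by (simp add: emb_def fps_eq_iff fps_mult_nth single0_sum mult_single)

lemma module_hscl: "module hscl"
  by unfold_locales (auto simp: hscl_def emb_add emb_one emb_mult algebra_simps)

lemma fps_nth_hscl: "fps_nth (hscl q F) n = (\<Sum>i=0..n. scl (fps_nth q i) (fps_nth F (n - i)))"
  by (simp add: hscl_def fps_mult_nth emb_def scl_def)

lemma emb_fps_X: "emb fps_X = fps_X"
  by (simp add: emb_def fps_eq_iff fps_X_def)

lemma fps_nth_hscl_X: "fps_nth (hscl fps_X F) n = (if n = 0 then 0 else fps_nth F (n - 1))"
  by (simp add: hscl_def emb_fps_X)

lemma fps_nth_h_extend:
  "fps_nth (h_extend f F) n = (\<Sum>i=0..n. lin_extend (\<lambda>x. fps_nth (f x) (n - i)) (fps_nth F i))"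
  by (simp add: h_extend_def)

lemma h_extend_basis: "h_extend f (fps_const (basis x)) = f x"
proof (rule fps_ext)
  fix n
  have "fps_nth (h_extend f (fps_const (basis x))) n
      = (\<Sum>i=0..n. if i = 0 then fps_nth (f x) n else 0)"
    unfolding fps_nth_h_extend
    by (intro sum.cong) (auto simp: lin_extend_basis lin_extend_zero)
  then show "fps_nth (h_extend f (fps_const (basis x))) n = fps_nth (f x) n" by simp
qed

lemma module_hom_h_extend: "module_hom hscl hscl (h_extend f)"
proof -
  have "h_extend f (F + G) = h_extend f F + h_extend f G" for F G
    by (simp add: fps_eq_iff fps_nth_h_extend lin_extend_add sum.distrib)
  moreover have "h_extend f (hscl q F) = hscl q (h_extend f F)" for q F
  proof (rule fps_ext)
    fix n
    define L where
      "L i j l = scl (fps_nth q i) (lin_extend (\<lambda>x. fps_nth (f x) l) (fps_nth F j))" for i j l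
    have "fps_nth (h_extend f (hscl q F)) n = (\<Sum>j=0..n. \<Sum>i=0..j. L i (j - i) (n - j))"
      by (simp add: fps_nth_h_extend fps_nth_hscl lin_extend_sum lin_extend_scl L_def)
    also have "\<dots> = (\<Sum>j=0..n. \<Sum>i=0..n - j. L j i (n - j - i))"
      by (rule fps_mult_assoc_lemma)
    also have "\<dots> = fps_nth (hscl q (h_extend f F)) n"
      by (simp add: fps_nth_h_extend fps_nth_hscl scl_sum L_def)
    finally show "fps_nth (h_extend f (hscl q F)) n = fps_nth (hscl q (h_extend f F)) n" .
  qed
  ultimately show ?thesis
    by (simp add: module_hom_iff module_hscl)
qed

lemma h_module_hom_unique:
  fixes D E :: "('b::comm_monoid_add \<Rightarrow>\<^sub>0 'k::comm_ring_1) fps \<Rightarrow> ('c::comm_monoid_add \<Rightarrow>\<^sub>0 'k) fps"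
  assumes D: "module_hom hscl hscl D" and E: "module_hom hscl hscl E"
    and eq: "\<And>x. D (fps_const (basis x)) = E (fps_const (basis x))"
  shows "D = E"
proof
  fix F
  interpret D: module_hom hscl hscl D by (rule D)
  interpret E: module_hom hscl hscl E by (rule E)
  have const: "D (fps_const a) = E (fps_const a)" for a
  proof -
    have fsum: "fps_const (\<Sum>i\<in>I. g i) = (\<Sum>i\<in>I. fps_const (g i))" for I and g :: "'b \<Rightarrow> 'b \<Rightarrow>\<^sub>0 'k"
      by (simp add: fps_eq_iff fps_sum_nth)
    have fscl: "fps_const (scl c b) = hscl (fps_const c) (fps_const b)" for c and b :: "'b \<Rightarrow>\<^sub>0 'k"
    proof -
      have "emb (fps_const c) = (fps_const (Poly_Mapping.single 0 c) :: ('b \<Rightarrow>\<^sub>0 'k) fps)"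
        by (simp add: emb_def fps_eq_iff)
      then show ?thesis by (simp add: hscl_def scl_def)
    qed
    show ?thesis
      by (subst (1 2) basis_expansion) (simp only: fsum fscl D.sum E.sum D.scale E.scale eq)
  qed
  have decomp: "F = fps_const (fps_nth F 0) + hscl fps_X (fps_shift 1 F)"
    for F :: "('b \<Rightarrow>\<^sub>0 'k) fps"
    by (rule fps_ext) (simp add: fps_nth_hscl_X)
  have DF: "D F = D (fps_const (fps_nth F 0)) + hscl fps_X (D (fps_shift 1 F))" for F
    using decomp[of F] D.add D.scale by metis
  have EF: "E F = E (fps_const (fps_nth F 0)) + hscl fps_X (E (fps_shift 1 F))" for F
    using decomp[of F] E.add E.scale by metis
  have "fps_nth (D F) n = fps_nth (E F) n" for n
  proof (induction n arbitrary: F)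
    case 0
    show ?case unfolding DF[of F] EF[of F] const by (simp add: fps_nth_hscl_X)
  next
    case (Suc n)
    show ?case unfolding DF[of F] EF[of F] const by (simp add: fps_nth_hscl_X Suc)
  qed
  then show "D F = E F" by (simp add: fps_eq_iff)
qed

lemma h_extend_mult:
  fixes f :: "'b::comm_monoid_add \<Rightarrow> ('c::comm_monoid_add \<Rightarrow>\<^sub>0 'k::comm_ring_1) fps"
  assumes "\<And>x y. f (x + y) = f x * f y"
  shows "h_extend f (F * G) = h_extend f F * h_extend f G"
proof -
  interpret f: module_hom hscl hscl "h_extend f" by (rule module_hom_h_extend)
  have homs: "module_hom hscl hscl (\<lambda>F. h_extend f (F * G))"
    "module_hom hscl hscl (\<lambda>F. h_extend f F * h_extend f G)"
    "module_hom hscl hscl (\<lambda>G. h_extend f (F * G))"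
    "module_hom hscl hscl (\<lambda>G. h_extend f F * h_extend f G)" for F G
  proof -
    have l: "hscl q A * B = hscl q (A * B)" "A * hscl q B = hscl q (A * B)"
      for q and A B :: "('d::comm_monoid_add \<Rightarrow>\<^sub>0 'k) fps"
      by (simp_all add: hscl_def ac_simps)
    show "module_hom hscl hscl (\<lambda>F. h_extend f (F * G))"
      "module_hom hscl hscl (\<lambda>F. h_extend f F * h_extend f G)"
      "module_hom hscl hscl (\<lambda>G. h_extend f (F * G))"
      "module_hom hscl hscl (\<lambda>G. h_extend f F * h_extend f G)"
      by (simp_all add: module_hom_iff module_hscl l f.add f.scale distrib_left distrib_right)
  qed
  have "h_extend f (fps_const (basis x) * G) = h_extend f (fps_const (basis x)) * h_extend f G"
    for x and G
  proof -
    have "(\<lambda>G. h_extend f (fps_const (basis x) * G))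
        = (\<lambda>G. h_extend f (fps_const (basis x)) * h_extend f G)"
      by (rule h_module_hom_unique[OF homs(3,4)])
        (simp add: h_extend_basis assms basis_mult[symmetric])
    then show ?thesis by (rule fun_cong)
  qed
  then have "(\<lambda>F. h_extend f (F * G)) = (\<lambda>F. h_extend f F * h_extend f G)"
    by (rule h_module_hom_unique[OF homs(1,2)])
  then show ?thesis by (rule fun_cong)
qed

theorem coprod_mult: "coprod (a * b) = coprod a * coprod b"
proof -
  define f where "f w = (\<Prod>s\<in>#w. tens (tree s) 1 + tens 1 (tree s :: 'a forest_alg))" for w
  have f: "f (v + w) = f v * f w" for v w by (simp add: f_def)
  have co: "coprod = lin_extend f" by (simp add: coprod_def f_def[abs_def])
  have bb: "lin_extend f (basis x * basis y) = f x * f y" for x y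
    by (simp add: basis_mult[symmetric] lin_extend_basis f)
  have "lin_extend f ((\<Sum>x\<in>K. scl (c x) (basis x)) * (\<Sum>y\<in>L. scl (d y) (basis y)))
      = lin_extend f (\<Sum>x\<in>K. scl (c x) (basis x)) * lin_extend f (\<Sum>y\<in>L. scl (d y) (basis y))"
    for K L c d
    by (simp add: sum_product scl_mult lin_extend_sum lin_extend_scl lin_extend_basis bb)
  from this[of "Poly_Mapping.lookup a" "Poly_Mapping.keys a" "Poly_Mapping.lookup b" "Poly_Mapping.keys b"]
  show ?thesis
    unfolding co basis_expansion[symmetric] .
qed

theorem linear_coprod: "Vector_Spaces.linear scl scl (coprod :: 'k::field forest_alg \<Rightarrow> _)"
  by unfold_locales
    (simp_all add: coprod_def lin_extend_add lin_extend_scl scl_add scl_add_left scl_scl scl_one)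

theorem coprod_one: "coprod 1 = 1"
  unfolding coprod_def basis_zero[symmetric] lin_extend_basis by (simp add: basis_zero)

theorem coprod_tree: "coprod (tree s) = tens (tree s) 1 + tens 1 (tree s)"
  unfolding coprod_def tree_def lin_extend_basis by simp

theorem module_hom_coprod_q: "module_hom hscl hscl (coprod_q q1 q2)"
  unfolding coprod_q_def by (rule module_hom_h_extend)

theorem coprod_q_mult: "coprod_q q1 q2 (F * G) = coprod_q q1 q2 F * coprod_q q1 q2 G"
  unfolding coprod_q_def by (rule h_extend_mult) simp

theorem coprod_q_one: "coprod_q q1 q2 1 = 1"
proof -
  have "coprod_q q1 q2 (fps_const (basis {#})) = 1"
    unfolding coprod_q_def h_extend_basis by simp
  then show ?thesis using basis_zero by (metis fps_const_1_eq_1 zero_multiset_def)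
qed

theorem coprod_q_tree_Node:
  "coprod_q q1 q2 (fps_const (tree (Node x))) = graft_step q1 q2 (coprod_q q1 q2 (fps_const (basis x)))"
  unfolding coprod_q_def tree_def h_extend_basis by simp

theorem coprod_q_unique:
  fixes D :: "'k::comm_ring_1 forest_alg fps \<Rightarrow> 'k forest_alg2 fps"
  assumes lin: "module_hom hscl hscl D" and mult: "\<And>F G. D (F * G) = D F * D G" and one: "D 1 = 1"
    and rec: "\<And>x. D (fps_const (tree (Node x))) = graft_step q1 q2 (D (fps_const (basis x)))"
  shows "D = coprod_q q1 q2"
proof (rule h_module_hom_unique[OF lin module_hom_coprod_q])
  have *: "D (fps_const (basis w)) = (\<Prod>s\<in>#w. coprod_q_tree q1 q2 s)"
    if "\<And>s. s \<in># w \<Longrightarrow> D (fps_const (tree s)) = coprod_q_tree q1 q2 s" for w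
    using that
  proof (induction w)
    case empty
    then show ?case using one basis_zero by (metis fps_const_1_eq_1 zero_multiset_def
        image_mset_empty prod_mset_empty)
  next
    case (add s w)
    then have "D (fps_const (tree s)) = coprod_q_tree q1 q2 s"
      "D (fps_const (basis w)) = (\<Prod>s\<in>#w. coprod_q_tree q1 q2 s)" by auto
    note step = this
    have "basis (add_mset s w) = (tree s * basis w :: 'k forest_alg)"
      unfolding tree_def by (simp add: basis_mult[symmetric])
    then have eq: "fps_const (basis (add_mset s w))
        = (fps_const (tree s) * fps_const (basis w) :: 'k forest_alg fps)"
      by simp
    show ?case unfolding eq mult step by simp
  qed
  have t: "D (fps_const (tree s)) = coprod_q_tree q1 q2 s" for s
  proof (induction s)
    case (Node x)
    then show ?case using *[of x] rec[of x] by simp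
  qed
  show "D (fps_const (basis x)) = coprod_q q1 q2 (fps_const (basis x))" for x
    using *[of x] t by (simp add: coprod_q_def h_extend_basis)
qed

end

theory Submission
  imports Defs
begin

text \<open>
  All trees being primitive, a degree preserving derivation \<open>\<psi>\<close> has boundary \<open>- coprod_bar (\<psi> s)\<close>
  at a tree \<open>s\<close>. Derivations are determined by their values on trees, and those of a degree
  preserving derivation of the algebra are arbitrary homogeneous elements; this gives (i).

  Modulo the square of the deformation parameter, equivalence means that the difference of the
  first order terms is a boundary. The first order term of \<open>coprod_q q1 q2\<close> is a derivation, and if
  \<open>m\<close> children of the root of \<open>s\<close> are leaves and \<open>s'\<close> arises from \<open>s\<close> by deleting one of them, it sends
  \<open>s\<close> to \<open>m (c2 s' \<otimes> \<bullet> + c1 \<bullet> \<otimes> s')\<close>. If the two coefficients of the difference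
  are both \<open>e\<close>, its value at \<open>s\<close> is \<open>m e coprod_bar (\<bullet> s')\<close>, so it is a boundary. Conversely, boundaries are
  symmetric since the coproduct is cocommutative, and \<open>s\<close> with two leaves attached to the root forces
  the two coefficients to agree.
\<close>

section \<open>Linear maps on monoid algebras\<close>

lemma linearI:
  fixes f :: "('b::comm_monoid_add \<Rightarrow>\<^sub>0 'k::field) \<Rightarrow> ('c::comm_monoid_add \<Rightarrow>\<^sub>0 'k)"
  assumes "\<And>a b. f (a + b) = f a + f b" "\<And>c a. f (scl c a) = scl c (f a)"
  shows "Vector_Spaces.linear scl scl f"
  by unfold_locales (simp_all add: assms scl_add scl_add_left scl_scl scl_one)

lemma linearD:
  fixes f :: "('b::comm_monoid_add \<Rightarrow>\<^sub>0 'k::field) \<Rightarrow> ('c::comm_monoid_add \<Rightarrow>\<^sub>0 'k)"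
  assumes "Vector_Spaces.linear scl scl f"
  shows "f (a + b) = f a + f b" "f (scl c a) = scl c (f a)" "f 0 = 0" "f (- a) = - f a"
    "f (a - b) = f a - f b" "f (\<Sum>i\<in>I. g i) = (\<Sum>i\<in>I. f (g i))"
proof -
  interpret Vector_Spaces.linear scl scl f by (rule assms)
  show "f (a + b) = f a + f b" "f (scl c a) = scl c (f a)" "f 0 = 0" "f (- a) = - f a"
    "f (a - b) = f a - f b" "f (\<Sum>i\<in>I. g i) = (\<Sum>i\<in>I. f (g i))"
    by (rule add scale zero neg diff sum)+
qed

lemma linear_eqI:
  fixes f g :: "('b::comm_monoid_add \<Rightarrow>\<^sub>0 'k::field) \<Rightarrow> ('c::comm_monoid_add \<Rightarrow>\<^sub>0 'k)"
  assumes f: "Vector_Spaces.linear scl scl f" and g: "Vector_Spaces.linear scl scl g"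
    and eq: "\<And>x. f (basis x) = g (basis x)"
  shows "f a = g a"
  by (subst (1 2) basis_expansion[of a]) (simp add: linearD[OF f] linearD[OF g] eq)

lemma linear_lin_extend: "Vector_Spaces.linear scl scl (lin_extend f)"
  for f :: "'b::comm_monoid_add \<Rightarrow> ('c::comm_monoid_add \<Rightarrow>\<^sub>0 'k::field)"
  by (rule linearI) (rule lin_extend_add lin_extend_scl)+

lemma scl_minus: "scl c (- a) = - scl c a" "scl (- c) a = - scl c a" "scl c (a - b) = scl c a - scl c b"
  by (simp_all add: scl_def algebra_simps single_uminus)

text \<open>Both sides are bilinear in \<open>a\<close> and \<open>b\<close>, so
  \<open>linear_eqI\<close>, applied to one argument at a time, reduces the claim to basis elements,
  where it is \<open>f\<close>.\<close>

lemma lin_extend_mult: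
  fixes f :: "'b::comm_monoid_add \<Rightarrow> ('c::comm_monoid_add \<Rightarrow>\<^sub>0 'k::field)"
  assumes f: "\<And>x y. f (x + y) = f x * f y"
  shows "lin_extend f (a * b) = lin_extend f a * lin_extend f b"
proof (rule linear_eqI[where f = "\<lambda>a. lin_extend f (a * b)" and g = "\<lambda>a. lin_extend f a * lin_extend f b"])
  fix x
  show "lin_extend f (basis x * b) = lin_extend f (basis x) * lin_extend f b"
    by (rule linear_eqI[where f = "\<lambda>b. lin_extend f (basis x * b)"])
      (auto intro!: linearI simp: distrib_left lin_extend_add lin_extend_scl scl_mult
        basis_mult[symmetric] lin_extend_basis f)
qed (auto intro!: linearI simp: distrib_right lin_extend_add lin_extend_scl scl_mult)

text \<open>Bilinearity again leaves only basis elements. This serves derivations of the forest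
  algebra (\<open>tree_derivation\<close>) as well as of its tensor square
  (\<open>tens_map\<close>).\<close>

lemma lin_extend_leibniz:
  fixes f :: "'b::comm_monoid_add \<Rightarrow> ('b \<Rightarrow>\<^sub>0 'k::field)"
  assumes f: "\<And>x y. f (x + y) = f x * basis y + basis x * f y"
  shows "lin_extend f (a * b) = lin_extend f a * b + a * lin_extend f b"
proof (rule linear_eqI[where f = "\<lambda>a. lin_extend f (a * b)"
      and g = "\<lambda>a. lin_extend f a * b + a * lin_extend f b"])
  fix x
  show "lin_extend f (basis x * b) = lin_extend f (basis x) * b + basis x * lin_extend f b"
    by (rule linear_eqI[where f = "\<lambda>b. lin_extend f (basis x * b)"])
      (auto intro!: linearI simp: distrib_left lin_extend_add lin_extend_scl scl_mult scl_add
        basis_mult[symmetric] lin_extend_basis f)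
qed (auto intro!: linearI simp: distrib_right lin_extend_add lin_extend_scl scl_mult scl_add)

section \<open>Tensors and the cocommutative coproduct\<close>

lemma lookup_tens:
  "Poly_Mapping.lookup (tens a b) (x, y) = Poly_Mapping.lookup a x * Poly_Mapping.lookup b y"
proof -
  have "Poly_Mapping.lookup (tens a b) (x, y) = (\<Sum>u\<in>Poly_Mapping.keys a. if u = x then
      (\<Sum>v\<in>Poly_Mapping.keys b. if v = y then Poly_Mapping.lookup a u * Poly_Mapping.lookup b v else 0) else 0)"
    unfolding tens_def lookup_sum
    by (intro sum.cong refl) (auto simp: lookup_single when_def intro!: sum.neutral)
  also have "\<dots> = Poly_Mapping.lookup a x * Poly_Mapping.lookup b y"
    by (auto simp: sum.delta' sum.delta in_keys_iff)
  finally show ?thesis .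
qed

lemma tens_simps:
  "tens (a + b) c = tens a c + tens b c" "tens c (a + b) = tens c a + tens c b"
  "tens (scl r a) c = scl r (tens a c)" "tens c (scl r a) = scl r (tens c a)"
  "tens 0 c = 0" "tens c 0 = 0"
  by (rule poly_mapping_eqI; clarsimp simp: lookup_tens lookup_add lookup_scl algebra_simps)+

lemma tens_basis: "tens (basis x) (basis y) = basis (x, y)"
  by (rule poly_mapping_eqI) (auto simp: lookup_tens basis_def lookup_single when_def split: if_splits)

text \<open>Every tensor factors as \<open>i a * j b\<close>, where \<open>i\<close> and
  \<open>j\<close> are the algebra embeddings onto the two tensor factors; the claim then follows
  from commutativity.\<close>

lemma tens_mult:
  fixes a b c d :: "'k::field forest_alg"
  shows "tens a b * tens c d = tens (a * c) (b * d)"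
proof -
  define i where "i = lin_extend (\<lambda>x. basis (x, 0) :: 'k forest_alg2)"
  define j where "j = lin_extend (\<lambda>y. basis (0, y) :: 'k forest_alg2)"
  have mult: "i (a * b) = i a * i b" "j (a * b) = j a * j b" for a b
    unfolding i_def j_def by (rule lin_extend_mult; simp add: basis_mult[symmetric])+
  have lin: "i (a + b) = i a + i b" "j (a + b) = j a + j b"
    "i (scl r a) = scl r (i a)" "j (scl r a) = scl r (j a)" for a b r
    by (simp_all add: i_def j_def lin_extend_add lin_extend_scl)
  have basis: "i (basis x) = basis (x, 0)" "j (basis x) = basis (0, x)" for x
    by (simp_all add: i_def j_def lin_extend_basis)
  have eq: "tens a b = i a * j b" for a b
  proof (rule linear_eqI[where f = "\<lambda>a. tens a b" and g = "\<lambda>a. i a * j b"])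
    fix x
    show "tens (basis x) b = i (basis x) * j b"
      by (rule linear_eqI[where f = "\<lambda>b. tens (basis x) b"])
        (auto intro!: linearI simp: tens_simps lin scl_mult distrib_left tens_basis basis
          basis_mult[symmetric])
  qed (auto intro!: linearI simp: tens_simps lin scl_mult distrib_right)
  show ?thesis unfolding eq mult by (simp add: ac_simps)
qed

lemma basis_add_mset: "basis (add_mset s w) = tree s * basis w"
  unfolding tree_def by (simp add: basis_mult[symmetric])

lemma coprod_basis_add_mset:
  "coprod (basis (add_mset s w)) = (basis ({#s#}, 0) + basis (0, {#s#})) * coprod (basis w)"
  unfolding basis_add_mset coprod_mult coprod_tree
  by (simp add: tree_def basis_zero[symmetric] tens_basis)

lemma coprod_basis_zero: "coprod (basis 0) = basis 0"
  by (simp add: basis_zero coprod_one)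

section \<open>Cocommutativity\<close>

definition swap :: "'k::field forest_alg2 \<Rightarrow> 'k forest_alg2" where
  "swap = lin_extend (\<lambda>(x, y). basis (y, x))"

text \<open>\<open>swap\<close> and \<open>coprod\<close> are algebra homomorphisms, and
  \<open>swap\<close> fixes the coproduct of each primitive tree; induction on the forest extends
  this to products.\<close>

lemma swap_coprod: "swap (coprod a) = coprod a" for a :: "'k::field forest_alg"
proof (rule linear_eqI[where f = "\<lambda>a. swap (coprod a)" and g = coprod])
  have lin: "Vector_Spaces.linear scl scl (swap :: 'k forest_alg2 \<Rightarrow> _)"
    unfolding swap_def by (rule linear_lin_extend)
  show "Vector_Spaces.linear scl scl (\<lambda>a :: 'k forest_alg. swap (coprod a))"
    by (rule linearI) (simp_all add: linearD[OF lin] linearD[OF linear_coprod])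
  show "Vector_Spaces.linear scl scl (coprod :: 'k forest_alg \<Rightarrow> _)" by (rule linear_coprod)
  have mult: "swap (a * b) = swap a * swap b" for a b :: "'k forest_alg2"
    unfolding swap_def by (rule lin_extend_mult) (auto simp: basis_mult[symmetric])
  have basis: "swap (basis (x, y)) = (basis (y, x) :: 'k forest_alg2)" for x y
    by (simp add: swap_def lin_extend_basis)
  show "swap (coprod (basis w)) = (coprod (basis w) :: 'k forest_alg2)" for w
  proof (induction w)
    case empty
    show ?case using basis[of 0 0] by (simp add: coprod_basis_zero zero_prod_def flip: zero_multiset_def)
  next
    case (add s w)
    then show ?case
      by (simp add: coprod_basis_add_mset mult linearD(1)[OF lin] basis add.commute)
  qed
qed

lemma lin_extend_swap: "lin_extend f (swap a) = lin_extend (\<lambda>(x, y). f (y, x)) a"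
  unfolding swap_def
  by (subst lin_extend_def[of "\<lambda>(x, y). basis (y, x)"])
    (auto simp: lin_extend_sum lin_extend_scl lin_extend_basis lin_extend_def[of "\<lambda>(x, y). f (y, x)"]
      intro!: sum.cong)

text \<open>The coefficient form of \<open>swap_coprod\<close>, the symmetry that later obstructs a
  difference of deformations from being a boundary.\<close>

lemma lookup_coprod_swap:
  "Poly_Mapping.lookup (coprod a) (x, y) = Poly_Mapping.lookup (coprod a) (y, x)"
  for a :: "'k::field forest_alg"
proof -
  have "Poly_Mapping.lookup (swap b) (x, y) = Poly_Mapping.lookup b (y, x)" for b :: "'k forest_alg2"
  proof -
    have "Poly_Mapping.lookup (swap b) (x, y)
        = (\<Sum>z\<in>Poly_Mapping.keys b. if z = (y, x) then Poly_Mapping.lookup b z else 0)"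
      unfolding swap_def lin_extend_def lookup_sum
      by (intro sum.cong) (auto simp: lookup_scl basis_def lookup_single when_def split: if_splits)
    then show ?thesis by (simp add: in_keys_iff)
  qed
  from this[of "coprod a"] show ?thesis by (simp add: swap_coprod)
qed

section \<open>Degrees\<close>

lemma forest_deg_simps:
  "forest_deg {#} = 0" "forest_deg (add_mset s w) = vertices s + forest_deg w"
  "forest_deg (v + w) = forest_deg v + forest_deg w"
  by (simp_all add: forest_deg_def)

lemma forest_deg_eq_0_iff: "forest_deg w = 0 \<longleftrightarrow> w = {#}"
  using vertices_pos by (cases w) (auto simp: forest_deg_simps)

lemma forest2_deg_add: "forest2_deg (p + q) = forest2_deg p + forest2_deg q"
  by (cases p; cases q) (simp add: forest2_deg_def forest_deg_simps)

abbreviation dot :: rtree where "dot \<equiv> Node {#}"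

lemma vertices_eq_1_iff: "vertices t = Suc 0 \<longleftrightarrow> t = dot"
  by (cases t) (auto simp: forest_deg_eq_0_iff simp flip: forest_deg_def simp del: sum_mset_0_iff)

section \<open>Homogeneous elements\<close>

lemma homogeneous_simps:
  "homogeneous d n 0"
  "homogeneous d n a \<Longrightarrow> homogeneous d n b \<Longrightarrow> homogeneous d n (a + b)"
  "homogeneous d n a \<Longrightarrow> homogeneous d n b \<Longrightarrow> homogeneous d n (a - b)"
  unfolding homogeneous_def by (fastforce simp: in_keys_iff lookup_add lookup_minus)+

lemma homogeneous_scl: "homogeneous d n a \<Longrightarrow> homogeneous d n (scl c a)"
  unfolding homogeneous_def by (auto simp: in_keys_iff lookup_scl)

lemma homogeneous_basis: "homogeneous d (d x) (basis x)"
  unfolding homogeneous_def by (auto simp: basis_def)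

lemma homogeneous_sum:
  "(\<And>i. i \<in> I \<Longrightarrow> homogeneous d n (g i)) \<Longrightarrow> homogeneous d n (\<Sum>i\<in>I. g i)"
  by (induction I rule: infinite_finite_induct) (auto intro: homogeneous_simps)

lemma homogeneous_sum_mset:
  "(\<And>i. i \<in># I \<Longrightarrow> homogeneous d n (g i)) \<Longrightarrow> homogeneous d n (\<Sum>i\<in>#I. g i)"
  by (induction I) (auto intro: homogeneous_simps)

lemma homogeneous_mult:
  assumes "\<And>x y. d (x + y) = d x + d y" "homogeneous d m a" "homogeneous d n b"
  shows "homogeneous d (m + n) (a * b)"
  unfolding homogeneous_def
proof
  fix z assume "z \<in> Poly_Mapping.keys (a * b)"
  then obtain x y where "x \<in> Poly_Mapping.keys a" "y \<in> Poly_Mapping.keys b" "z = x + y"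
    using keys_mult[of a b] by auto
  then show "d z = m + n" using assms by (auto simp: homogeneous_def)
qed

lemma homogeneous_lin_extend:
  assumes "homogeneous d n a" "\<And>x. d x = n \<Longrightarrow> homogeneous e n (f x)"
  shows "homogeneous e n (lin_extend f a)"
  using assms(1) unfolding lin_extend_def
  by (intro homogeneous_sum homogeneous_scl assms(2)) (simp add: homogeneous_def)

lemma homogeneous_tens:
  assumes "homogeneous forest_deg m a" "homogeneous forest_deg n b"
  shows "homogeneous forest2_deg (m + n) (tens a b)"
  unfolding homogeneous_def
proof safe
  fix x y assume "(x, y) \<in> Poly_Mapping.keys (tens a b)"
  then have "x \<in> Poly_Mapping.keys a" "y \<in> Poly_Mapping.keys b"
    by (auto simp: in_keys_iff lookup_tens)
  then show "forest2_deg (x, y) = m + n" using assms by (simp add: homogeneous_def forest2_deg_def)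
qed

lemma homogeneous_tree: "homogeneous forest_deg (vertices s) (tree s)"
  using homogeneous_basis[of forest_deg "{#s#}"] by (simp add: tree_def forest_deg_simps)

lemma homogeneous_coprod:
  fixes a :: "'k::field forest_alg"
  assumes "homogeneous forest_deg n a"
  shows "homogeneous forest2_deg n (coprod a)"
proof -
  have "homogeneous forest2_deg (forest_deg w) (coprod (basis w) :: 'k forest_alg2)" for w
  proof (induction w)
    case empty
    then show ?case
      using homogeneous_basis[of forest2_deg "0"]
      by (simp add: coprod_basis_zero forest_deg_simps zero_prod_def forest2_deg_def flip: zero_multiset_def)
  next
    case (add s w)
    have "homogeneous forest2_deg (vertices s) (basis ({#s#}, 0) + basis (0, {#s#}) :: 'k forest_alg2)"
      using homogeneous_basis[of forest2_deg "({#s#}, 0)"] homogeneous_basis[of forest2_deg "(0, {#s#})"]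
      by (intro homogeneous_simps) (simp_all add: forest2_deg_def forest_deg_simps)
    from homogeneous_mult[OF forest2_deg_add this add] show ?case
      by (simp add: coprod_basis_add_mset forest_deg_simps)
  qed
  then have "homogeneous forest2_deg n (lin_extend (\<lambda>w. coprod (basis w)) a)"
    by (intro homogeneous_lin_extend[OF assms]) auto
  moreover have "lin_extend (\<lambda>w. coprod (basis w)) a = coprod a"
    by (rule linear_eqI[OF linear_lin_extend linear_coprod]) (simp add: lin_extend_basis)
  ultimately show ?thesis by simp
qed

lemma homogeneous_expansion:
  assumes "homogeneous forest_deg n a"
  shows "a = (\<Sum>w | forest_deg w = n. scl (Poly_Mapping.lookup a w) (basis w))"
  using assms
  by (subst basis_expansion, intro sum.mono_neutral_left)
    (auto simp: finite_forest_deg homogeneous_def in_keys_iff scl_zero)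

section \<open>Derivations and their boundaries\<close>

lemma derivationsD:
  assumes "\<phi> \<in> derivations \<rho>"
  shows "Vector_Spaces.linear scl scl \<phi>" "\<phi> (a * b) = \<phi> a * \<rho> b + \<rho> a * \<phi> b"
  using assms by (auto simp: derivations_def)

lemma derivation_one:
  assumes "\<phi> \<in> derivations \<rho>" "\<rho> 1 = 1"
  shows "\<phi> 1 = 0"
  using derivationsD(2)[OF assms(1), of 1 1] assms(2) by simp

text \<open>Trees generate the algebra, and a derivation kills \<open>1\<close> because
  \<open>\<rho> 1 = 1\<close>; the Leibniz rule therefore fixes its value on every forest.\<close>

lemma derivation_eqI:
  assumes "\<phi> \<in> derivations \<rho>" "\<phi>' \<in> derivations \<rho>" "\<rho> 1 = 1"
    and eq: "\<And>s. \<phi> (tree s) = \<phi>' (tree s)"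
  shows "\<phi> = \<phi>'"
proof
  fix a
  show "\<phi> a = \<phi>' a"
  proof (rule linear_eqI[OF derivationsD(1) derivationsD(1), OF assms(1,2)])
    show "\<phi> (basis w) = \<phi>' (basis w)" for w
    proof (induction w)
      case empty
      then show ?case
        using assms(1-3) by (simp add: derivation_one basis_zero flip: zero_multiset_def)
    next
      case (add s w)
      then show ?case
        by (simp add: basis_add_mset derivationsD(2)[OF assms(1)] derivationsD(2)[OF assms(2)] eq)
    qed
  qed
qed

section \<open>Derivations with prescribed values on trees\<close>

text \<open>The expanded Leibniz rule: the multiset sum runs over occurrences, so a tree of
  multiplicity m contributes m times, each term replacing one copy by its prescribed value.\<close>

definition tree_derivation :: "(rtree \<Rightarrow> 'k::field forest_alg) \<Rightarrow> 'k forest_alg \<Rightarrow> 'k forest_alg" where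
  "tree_derivation D = lin_extend (\<lambda>w. \<Sum>s\<in>#w. D s * basis (w - {#s#}))"

lemma tree_derivation_tree: "tree_derivation D (tree s) = D s"
  by (simp add: tree_derivation_def tree_def lin_extend_basis basis_zero flip: zero_multiset_def)

lemma tree_derivation_Der0_1:
  assumes D: "\<And>s. homogeneous forest_deg (vertices s) (D s)"
  shows "tree_derivation D \<in> Der0_1"
proof -
  let ?f = "\<lambda>w. \<Sum>s\<in>#w. D s * basis (w - {#s#})"
  \<comment> \<open>In the sum over \<open>v + w\<close>, the occurrences from \<open>v\<close>
    leave \<open>w\<close> untouched and it factors out. Exchanging \<open>v\<close> and
    \<open>w\<close> treats the others, and the two halves give the Leibniz rule.\<close>
  have half: "(\<Sum>s\<in>#v. D s * basis (v + w - {#s#})) = ?f v * basis w" for v w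
  proof -
    have "image_mset (\<lambda>s. D s * basis (v + w - {#s#})) v = image_mset (\<lambda>s. D s * basis (v - {#s#}) * basis w) v"
      by (intro image_mset_cong) (auto simp: mult.assoc basis_mult[symmetric])
    then show ?thesis by (simp add: sum_mset_distrib_right)
  qed
  have "?f (v + w) = ?f v * basis w + basis v * ?f w" for v w
    using half[of v w] half[of w v] by (simp add: add.commute mult.commute)
  then have "tree_derivation D (a * b) = tree_derivation D a * b + a * tree_derivation D b" for a b
    unfolding tree_derivation_def by (rule lin_extend_leibniz)
  moreover have "Vector_Spaces.linear scl scl (tree_derivation D)"
    unfolding tree_derivation_def by (rule linear_lin_extend)
  moreover have "homogeneous forest_deg n (tree_derivation D a)" if "homogeneous forest_deg n a" for n a
    unfolding tree_derivation_def
  proof (rule homogeneous_lin_extend[OF that], rule homogeneous_sum_mset)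
    fix w s assume w: "forest_deg w = n" "s \<in># w"
    then obtain v where v: "w = add_mset s v" by (metis insert_DiffM)
    show "homogeneous forest_deg n (D s * basis (w - {#s#}))"
      using homogeneous_mult[OF forest_deg_simps(3) D homogeneous_basis, of s v] w
      by (simp add: v forest_deg_simps)
  qed
  ultimately show ?thesis by (simp add: Der0_1_def derivations_def)
qed

lemma Der0_1D:
  assumes "\<psi> \<in> Der0_1"
  shows "\<psi> \<in> derivations (\<lambda>a. a)" "Vector_Spaces.linear scl scl \<psi>" "\<psi> (a * b) = \<psi> a * b + a * \<psi> b"
    "homogeneous forest_deg n a \<Longrightarrow> homogeneous forest_deg n (\<psi> a)" "\<psi> 1 = 0"
  using assms derivation_one[of \<psi> "\<lambda>a. a"] by (auto simp: Der0_1_def derivations_def)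

section \<open>The boundary of a degree preserving derivation\<close>

lemma linear_tens_map: "Vector_Spaces.linear scl scl (tens_map f g)"
  for f g :: "'k::field forest_alg \<Rightarrow> 'k forest_alg"
  unfolding tens_map_def by (rule linear_lin_extend)

text \<open>Products of basis tensors are formed factorwise, so a derivation acting on one tensor
  factor and the identity on the other form a derivation of the tensor square.\<close>

lemma tens_map_leibniz:
  assumes "\<psi> \<in> Der0_1"
  shows "tens_map \<psi> id (p * q) = tens_map \<psi> id p * q + p * tens_map \<psi> id q"
    "tens_map id \<psi> (p * q) = tens_map id \<psi> p * q + p * tens_map id \<psi> q"
  unfolding tens_map_def
  by (rule lin_extend_leibniz;
      auto simp: basis_mult Der0_1D(3)[OF assms] tens_simps tens_mult simp flip: tens_basis)+

text \<open>Since \<open>coprod\<close> is multiplicative, each of the three terms of the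
  differential obeys the Leibniz rule over \<open>coprod\<close>, and each preserves the
  degree.\<close>

lemma hochschild_d_Der0_2:
  fixes \<psi> :: "'k::field forest_alg \<Rightarrow> 'k forest_alg"
  assumes \<psi>: "\<psi> \<in> Der0_1"
  shows "hochschild_d \<psi> \<in> Der0_2"
proof -
  have "Vector_Spaces.linear scl scl (hochschild_d \<psi>)"
    unfolding hochschild_d_def
    by (rule linearI) (simp_all add: linearD[OF linear_tens_map] linearD[OF linear_coprod]
        linearD[OF Der0_1D(2)[OF \<psi>]] scl_add scl_minus)
  moreover have "hochschild_d \<psi> (a * b) = hochschild_d \<psi> a * coprod b + coprod a * hochschild_d \<psi> b" for a b
    unfolding hochschild_d_def
    by (simp add: coprod_mult tens_map_leibniz[OF \<psi>] Der0_1D(3)[OF \<psi>] linearD(1)[OF linear_coprod]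
        algebra_simps)
  moreover have "homogeneous forest2_deg n (hochschild_d \<psi> a)" if "homogeneous forest_deg n a" for n a
  proof -
    have "homogeneous forest2_deg n (case x of (u, v) \<Rightarrow> tens (\<psi> (basis u)) (basis v))"
      "homogeneous forest2_deg n (case x of (u, v) \<Rightarrow> tens (basis u) (\<psi> (basis v)))"
      if "forest2_deg x = n" for x
      using that[symmetric] homogeneous_tens[OF Der0_1D(4)[OF \<psi> homogeneous_basis] homogeneous_basis]
        homogeneous_tens[OF homogeneous_basis Der0_1D(4)[OF \<psi> homogeneous_basis]]
      by (cases x; simp add: forest2_deg_def)+
    then show ?thesis
      unfolding hochschild_d_def tens_map_def id_def
      by (intro homogeneous_simps homogeneous_lin_extend[OF homogeneous_coprod] homogeneous_coprod
          Der0_1D(4)[OF \<psi>] that)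
  qed
  ultimately show ?thesis by (simp add: Der0_2_def derivations_def)
qed

lemma linear_coprod_bar: "Vector_Spaces.linear scl scl (coprod_bar :: 'k::field forest_alg \<Rightarrow> _)"
  unfolding coprod_bar_def
  by (rule linearI) (simp_all add: linearD[OF linear_coprod] tens_simps scl_add scl_minus)

text \<open>As \<open>s\<close> is primitive and \<open>\<psi> 1 = 0\<close>, the first two terms of
  the differential are \<open>tens (\<psi> (tree s)) 1\<close> and
  \<open>tens 1 (\<psi> (tree s))\<close>, which is what \<open>coprod_bar\<close>
  subtracts.\<close>

lemma hochschild_d_tree:
  assumes \<psi>: "\<psi> \<in> Der0_1"
  shows "hochschild_d \<psi> (tree s) = - coprod_bar (\<psi> (tree s))"
  using Der0_1D(5)[OF \<psi>]
  by (simp add: hochschild_d_def coprod_tree linearD[OF linear_tens_map] coprod_bar_def)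
    (simp add: tens_map_def tree_def tens_basis basis_zero[symmetric] lin_extend_basis tens_simps)

lemma boundaries0_2_eq:
  "(boundaries0_2 :: ('k::field forest_alg \<Rightarrow> 'k forest_alg2) set) =
    {\<phi> \<in> Der0_2. \<exists>c. \<forall>s.
       \<phi> (tree s) = (\<Sum>w | forest_deg w = vertices s. scl (c s w) (coprod_bar (basis w)))}"
proof (intro set_eqI iffI)
  fix \<phi> :: "'k forest_alg \<Rightarrow> 'k forest_alg2"
  assume "\<phi> \<in> boundaries0_2"
  then obtain \<psi> where \<psi>: "\<psi> \<in> Der0_1" and \<phi>: "\<phi> = hochschild_d \<psi>" by (auto simp: boundaries0_2_def)
  have "\<phi> (tree s) = (\<Sum>w | forest_deg w = vertices s.
      scl (- Poly_Mapping.lookup (\<psi> (tree s)) w) (coprod_bar (basis w)))" for s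
    unfolding \<phi> hochschild_d_tree[OF \<psi>]
    by (subst homogeneous_expansion[OF Der0_1D(4)[OF \<psi> homogeneous_tree]])
      (simp add: linearD[OF linear_coprod_bar] scl_minus sum_negf)
  then have "\<exists>c. \<forall>s. \<phi> (tree s)
      = (\<Sum>w | forest_deg w = vertices s. scl (c s w) (coprod_bar (basis w)))"
    by (intro exI[of _ "\<lambda>s w. - Poly_Mapping.lookup (\<psi> (tree s)) w"]) blast
  then show "\<phi> \<in> {\<phi> \<in> Der0_2. \<exists>c. \<forall>s.
       \<phi> (tree s) = (\<Sum>w | forest_deg w = vertices s. scl (c s w) (coprod_bar (basis w)))}"
    using hochschild_d_Der0_2[OF \<psi>] \<phi> by simp
next
  fix \<phi> :: "'k forest_alg \<Rightarrow> 'k forest_alg2"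
  assume "\<phi> \<in> {\<phi> \<in> Der0_2. \<exists>c. \<forall>s.
       \<phi> (tree s) = (\<Sum>w | forest_deg w = vertices s. scl (c s w) (coprod_bar (basis w)))}"
  then obtain c where \<phi>: "\<phi> \<in> Der0_2"
    and c: "\<And>s. \<phi> (tree s) = (\<Sum>w | forest_deg w = vertices s. scl (c s w) (coprod_bar (basis w)))"
    by auto
  \<comment> \<open>The sign cancels the one in \<open>hochschild_d_tree\<close>.\<close>
  define \<psi> where "\<psi> = tree_derivation (\<lambda>s. - (\<Sum>w | forest_deg w = vertices s. scl (c s w) (basis w)))"
  have \<psi>: "\<psi> \<in> Der0_1"
    unfolding \<psi>_def
    by (rule tree_derivation_Der0_1)
      (auto simp: sum_negf[symmetric] scl_minus(2)[symmetric] homogeneous_basis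
        dest!: sym[of "forest_deg _"] intro!: homogeneous_sum homogeneous_scl)
  have "hochschild_d \<psi> = \<phi>"
  proof (rule derivation_eqI)
    show "hochschild_d \<psi> \<in> derivations coprod" "\<phi> \<in> derivations coprod"
      using hochschild_d_Der0_2[OF \<psi>] \<phi> by (auto simp: Der0_2_def)
    show "hochschild_d \<psi> (tree s) = \<phi> (tree s)" for s
      by (simp add: hochschild_d_tree[OF \<psi>] c) (simp add: \<psi>_def tree_derivation_tree linearD[OF linear_coprod_bar])
  qed (rule coprod_one)
  then show "\<phi> \<in> boundaries0_2" using \<psi> by (auto simp: boundaries0_2_def)
qed

section \<open>Low order terms of the deformed coproducts\<close>

text \<open>A predicate stable under translation selects basis elements that span an ideal.\<close>

lemma keys_mult_upward:
  assumes "\<And>u x. P u \<Longrightarrow> P (x + u)" "\<forall>u\<in>Poly_Mapping.keys b. P u"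
  shows "\<forall>u\<in>Poly_Mapping.keys (a * b). P u"
  using keys_mult[of a b] assms by fastforce

lemma keys_add_Ball:
  assumes "\<forall>u\<in>Poly_Mapping.keys a. P u" "\<forall>u\<in>Poly_Mapping.keys b. P u"
  shows "\<forall>u\<in>Poly_Mapping.keys (a + b). P u"
  using keys_add[of a b] assms by blast

text \<open>At orders zero and one a power \<open>q ^ n\<close> matters only for
  \<open>n < 2\<close>, so tensors whose second factor has degree at least two may be collected in
  \<open>R\<close>. The only forest of degree one is a single leaf; it can be split off in as many
  ways as \<open>w\<close> contains leaves.\<close>

lemma coprod_basis_truncation:
  "\<exists>R :: 'k::field forest_alg2. coprod (basis w)
      = basis (w, 0) + scl (of_nat (count w dot)) (basis (w - {#dot#}, {#dot#})) + R
    \<and> (\<forall>u\<in>Poly_Mapping.keys R. 2 \<le> forest_deg (snd u))"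
proof (induction w)
  case empty
  then show ?case
    by (intro exI[of _ 0]) (simp add: coprod_basis_zero scl_zero zero_prod_def flip: zero_multiset_def)
next
  case (add s w)
  let ?m = "of_nat (count w dot) :: 'k"
  obtain R :: "'k forest_alg2" where R: "coprod (basis w)
      = basis (w, 0) + scl ?m (basis (w - {#dot#}, {#dot#})) + R"
    "\<forall>u\<in>Poly_Mapping.keys R. 2 \<le> forest_deg (snd u)" using add by blast
  define S where "S = (basis ({#s#}, 0) + basis (0, {#s#})) * R"
  have S: "\<forall>u\<in>Poly_Mapping.keys S. 2 \<le> forest_deg (snd u)"
    unfolding S_def by (rule keys_mult_upward[OF _ R(2)]) (auto simp: forest_deg_simps)
  \<comment> \<open>The new remainder: besides \<open>S\<close>, a split-off leaf joined by
    \<open>s\<close>, and \<open>s\<close> alone in the second factor. If \<open>s\<close> is itself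
    a leaf, the latter term instead raises the leaf count by one.\<close>
  define Q where "Q = scl ?m (basis (w - {#dot#}, {#dot, s#})) + (if s = dot then 0 else basis (w, {#s#})) + S"
  have Q: "\<forall>u\<in>Poly_Mapping.keys Q. 2 \<le> forest_deg (snd u)"
  proof
    fix u assume "u \<in> Poly_Mapping.keys Q"
    then consider "u = (w - {#dot#}, {#dot, s#})" | "s \<noteq> dot" "u = (w, {#s#})" | "u \<in> Poly_Mapping.keys S"
      by (fastforce simp: Q_def in_keys_iff lookup_add lookup_scl basis_def lookup_single when_def
          split: if_splits)
    then show "2 \<le> forest_deg (snd u)"
    proof cases
      case 1
      then show ?thesis using vertices_pos[of s] by (simp add: forest_deg_simps)
    next
      case 2
      then show ?thesis using vertices_pos[of s] vertices_eq_1_iff[of s] by (simp add: forest_deg_simps)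
    qed (use S in auto)
  qed
  \<comment> \<open>Multiset difference is truncated, so the two forests may differ when
    \<open>w\<close> has no leaf; then the coefficient \<open>?m\<close> is zero.\<close>
  have shift: "scl ?m (basis (add_mset s (w - {#dot#}), {#dot#}))
      = scl ?m (basis (add_mset s w - {#dot#}, {#dot#}))"
  proof (cases "dot \<in># w")
    case False
    then show ?thesis by (simp add: not_in_iff scl_zero)
  qed simp
  have "coprod (basis (add_mset s w)) = basis (add_mset s w, 0) + scl ?m (basis (add_mset s w - {#dot#}, {#dot#}))
      + basis (w, {#s#}) + scl ?m (basis (w - {#dot#}, {#dot, s#})) + S"
    unfolding coprod_basis_add_mset R(1) shift[symmetric] S_def
    by (simp add: distrib_left distrib_right scl_mult scl_add basis_mult[symmetric])
  also have "\<dots> = basis (add_mset s w, 0)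
      + scl (of_nat (count (add_mset s w) dot)) (basis (add_mset s w - {#dot#}, {#dot#})) + Q"
    by (auto simp: Q_def scl_add_left scl_one)
  finally show ?case using Q by blast
qed

text \<open>The tests on \<open>y\<close> read off the terms of
  \<open>coprod_basis_truncation\<close>, since \<open>R\<close> has no term of degree below two
  there. The tests on \<open>x\<close> follow by cocommutativity, with the arguments of
  \<open>G\<close> exchanged.\<close>

lemma lin_extend_coprod_basis_low_degree:
  fixes G :: "forest \<Rightarrow> forest \<Rightarrow> 'c::comm_monoid_add \<Rightarrow>\<^sub>0 'k::field"
  shows "lin_extend (\<lambda>(x, y). if forest_deg y = 0 then G x y else 0) (coprod (basis w)) = G w {#}"
    "lin_extend (\<lambda>(x, y). if forest_deg x = 0 then G x y else 0) (coprod (basis w)) = G {#} w"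
    "lin_extend (\<lambda>(x, y). if forest_deg y = 1 then G x y else 0) (coprod (basis w))
      = scl (of_nat (count w dot)) (G (w - {#dot#}) {#dot#})"
    "lin_extend (\<lambda>(x, y). if forest_deg x = 1 then G x y else 0) (coprod (basis w))
      = scl (of_nat (count w dot)) (G {#dot#} (w - {#dot#}))"
proof -
  obtain R :: "'k forest_alg2" where R: "coprod (basis w)
      = basis (w, 0) + scl (of_nat (count w dot)) (basis (w - {#dot#}, {#dot#})) + R"
    "\<forall>u\<in>Poly_Mapping.keys R. 2 \<le> forest_deg (snd u)" using coprod_basis_truncation by blast
  have van: "lin_extend (\<lambda>(x, y). if forest_deg y = n then G x y else 0) R = 0" if "n < 2"
    for n and G :: "forest \<Rightarrow> forest \<Rightarrow> 'c \<Rightarrow>\<^sub>0 'k"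
    unfolding lin_extend_def using R(2) that by (intro sum.neutral) (auto simp: scl_zero)
  have 0: "lin_extend (\<lambda>(x, y). if forest_deg y = 0 then G x y else 0) (coprod (basis w)) = G w {#}"
    and 1: "lin_extend (\<lambda>(x, y). if forest_deg y = 1 then G x y else 0) (coprod (basis w))
      = scl (of_nat (count w dot)) (G (w - {#dot#}) {#dot#})"
    for G :: "forest \<Rightarrow> forest \<Rightarrow> 'c \<Rightarrow>\<^sub>0 'k"
    using van[of 0 G] van[of 1 G]
    by (simp_all add: R(1) lin_extend_add lin_extend_scl lin_extend_basis forest_deg_simps scl_zero)
  show "lin_extend (\<lambda>(x, y). if forest_deg y = 0 then G x y else 0) (coprod (basis w)) = G w {#}" by (rule 0)
  show "lin_extend (\<lambda>(x, y). if forest_deg y = 1 then G x y else 0) (coprod (basis w))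
      = scl (of_nat (count w dot)) (G (w - {#dot#}) {#dot#})" by (rule 1)
  show "lin_extend (\<lambda>(x, y). if forest_deg x = 0 then G x y else 0) (coprod (basis w)) = G {#} w"
    using 0[of "\<lambda>x y. G y x"] by (subst swap_coprod[symmetric]) (simp add: lin_extend_swap)
  show "lin_extend (\<lambda>(x, y). if forest_deg x = 1 then G x y else 0) (coprod (basis w))
      = scl (of_nat (count w dot)) (G {#dot#} (w - {#dot#}))"
    using 1[of "\<lambda>x y. G y x"] by (subst swap_coprod[symmetric]) (simp add: lin_extend_swap)
qed

section \<open>Grafting at orders zero and one\<close>

lemma lin_extend_fun_add: "lin_extend (\<lambda>x. f x + g x) a = lin_extend f a + lin_extend g a"
  by (simp add: lin_extend_def scl_add sum.distrib)

lemma lin_extend_fun_scl: "lin_extend (\<lambda>x. scl c (f x)) a = scl c (lin_extend f a)"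
  by (simp add: lin_extend_def scl_sum scl_scl mult.commute)

lemma fps_nth_power_low:
  fixes q :: "'a::comm_ring_1 fps"
  assumes "fps_nth q 0 = 0"
  shows "fps_nth (q ^ n) 0 = (if n = 0 then 1 else 0)"
    "fps_nth (q ^ n) (Suc 0) = (if n = 1 then fps_nth q 1 else 0)"
proof -
  show 0: "fps_nth (q ^ n) 0 = (if n = 0 then 1 else 0)" for n
    using assms by (cases n) auto
  show "fps_nth (q ^ n) (Suc 0) = (if n = 1 then fps_nth q 1 else 0)"
    by (cases n) (auto simp: fps_mult_nth assms 0)
qed

text \<open>The order zero coefficient of \<open>graft_step\<close>: a power of a series without
  constant term survives at order zero only for exponent zero.\<close>

definition graft_0 :: "forest \<times> forest \<Rightarrow> 'k::field forest_alg2" where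
  "graft_0 = (\<lambda>(x, y). (if forest_deg y = 0 then tens (tree (Node x)) (basis y) else 0)
     + (if forest_deg x = 0 then tens (basis x) (tree (Node y)) else 0))"

text \<open>The order one coefficient of \<open>graft_step\<close>, for series with linear
  coefficients \<open>c1\<close> and \<open>c2\<close>: only exponent one contributes.\<close>

definition graft_1 :: "'k::field \<Rightarrow> 'k \<Rightarrow> forest \<times> forest \<Rightarrow> 'k forest_alg2" where
  "graft_1 c1 c2 = (\<lambda>(x, y). scl c2 (if forest_deg y = 1 then tens (tree (Node x)) (basis y) else 0)
     + scl c1 (if forest_deg x = 1 then tens (basis x) (tree (Node y)) else 0))"

lemma graft_step_nth:
  fixes q1 q2 :: "'k::field fps"
  assumes "fps_nth q1 0 = 0" "fps_nth q2 0 = 0"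
  shows "fps_nth (graft_step q1 q2 P) 0 = lin_extend graft_0 (fps_nth P 0)"
    "fps_nth (graft_step q1 q2 P) 1 =
       lin_extend (graft_1 (fps_nth q1 1) (fps_nth q2 1)) (fps_nth P 0) + lin_extend graft_0 (fps_nth P 1)"
proof -
  have 0: "fps_nth (case z of (x, y) \<Rightarrow>
       hscl (q2 ^ forest_deg y) (fps_const (tens (tree (Node x)) (basis y)))
     + hscl (q1 ^ forest_deg x) (fps_const (tens (basis x) (tree (Node y))))) 0 = graft_0 z" for z
    using assms by (cases z) (simp add: fps_nth_hscl fps_nth_power_low graft_0_def scl_one scl_zero)
  have 1: "fps_nth (case z of (x, y) \<Rightarrow>
       hscl (q2 ^ forest_deg y) (fps_const (tens (tree (Node x)) (basis y)))
     + hscl (q1 ^ forest_deg x) (fps_const (tens (basis x) (tree (Node y))))) 1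
     = graft_1 (fps_nth q1 1) (fps_nth q2 1) z" for z
    using assms by (cases z) (simp add: fps_nth_hscl fps_nth_power_low graft_1_def scl_one scl_zero)
  show "fps_nth (graft_step q1 q2 P) 0 = lin_extend graft_0 (fps_nth P 0)"
    by (simp add: graft_step_def fps_nth_h_extend 0)
  show "fps_nth (graft_step q1 q2 P) 1 =
       lin_extend (graft_1 (fps_nth q1 1) (fps_nth q2 1)) (fps_nth P 0) + lin_extend graft_0 (fps_nth P 1)"
    using 1 by (simp add: graft_step_def fps_nth_h_extend 0)
qed

text \<open>Only the two extreme terms of the coproduct of \<open>w\<close> survive, and grafting
  them makes the new tree primitive. Hence the recursion at parameter zero reproduces
  \<open>coprod\<close>.\<close>

lemma lin_extend_graft_0: "lin_extend graft_0 (coprod (basis w)) = coprod (tree (Node w))"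
proof -
  have eq: "graft_0 = (\<lambda>z. (case z of (x, y) \<Rightarrow> if forest_deg y = 0 then tens (tree (Node x)) (basis y) else 0)
     + (case z of (x, y) \<Rightarrow> if forest_deg x = 0 then tens (basis x) (tree (Node y)) else 0))"
    by (auto simp: graft_0_def)
  show ?thesis
    unfolding eq lin_extend_fun_add lin_extend_coprod_basis_low_degree
    by (simp add: coprod_tree basis_zero flip: zero_multiset_def)
qed

lemma lin_extend_graft_1:
  "lin_extend (graft_1 c1 c2) (coprod (basis w)) = scl (of_nat (count w dot))
     (scl c2 (tens (tree (Node (w - {#dot#}))) (tree dot)) + scl c1 (tens (tree dot) (tree (Node (w - {#dot#})))))"
proof -
  have "graft_1 c1 c2 = (\<lambda>z. scl c2 (case z of (x, y) \<Rightarrow> if forest_deg y = 1 then tens (tree (Node x)) (basis y) else 0)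
     + scl c1 (case z of (x, y) \<Rightarrow> if forest_deg x = 1 then tens (basis x) (tree (Node y)) else 0))"
    by (auto simp: graft_1_def)
  then show ?thesis
    by (simp only: lin_extend_fun_add lin_extend_fun_scl lin_extend_coprod_basis_low_degree scl_add scl_scl
        tree_def mult.commute)
qed

section \<open>The order zero and order one terms of the deformed coproduct\<close>

lemma coprod_q_nth_0:
  fixes q1 q2 :: "'k::field fps"
  assumes "fps_nth q1 0 = 0" "fps_nth q2 0 = 0"
  shows "fps_nth (coprod_q q1 q2 F) 0 = coprod (fps_nth F 0)"
proof -
  have prod: "fps_nth (\<Prod>s\<in>#w. coprod_q_tree q1 q2 s) 0 = coprod (basis w)"
    if "\<And>s. s \<in># w \<Longrightarrow> fps_nth (coprod_q_tree q1 q2 s) 0 = coprod (tree s)" for w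
    using that
  proof (induction w)
    case empty
    then show ?case using coprod_one basis_zero by (metis fps_one_nth image_mset_empty prod_mset_empty zero_multiset_def)
  next
    case (add s w)
    then show ?case by (simp add: basis_add_mset coprod_mult)
  qed
  have tree: "fps_nth (coprod_q_tree q1 q2 s) 0 = coprod (tree s)" for s
  proof (induction s)
    case (Node w)
    then show ?case using prod[of w] by (simp add: graft_step_nth[OF assms] lin_extend_graft_0)
  qed
  have "fps_nth (coprod_q q1 q2 F) 0 = lin_extend (\<lambda>w. coprod (basis w)) (fps_nth F 0)"
    by (simp add: coprod_q_def fps_nth_h_extend prod tree)
  also have "\<dots> = coprod (fps_nth F 0)"
    by (rule linear_eqI[OF linear_lin_extend linear_coprod]) (simp add: lin_extend_basis)
  finally show ?thesis .
qed

definition first_order :: "'k::field fps \<Rightarrow> 'k fps \<Rightarrow> 'k forest_alg \<Rightarrow> 'k forest_alg2" where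
  "first_order q1 q2 a = fps_nth (coprod_q q1 q2 (fps_const a)) 1"

lemma first_order_eq: "first_order q1 q2 = lin_extend (\<lambda>w. fps_nth (\<Prod>s\<in>#w. coprod_q_tree q1 q2 s) 1)"
  by (rule ext) (simp add: first_order_def coprod_q_def fps_nth_h_extend lin_extend_zero)

lemma coprod_q_nth_1:
  fixes q1 q2 :: "'k::field fps"
  assumes "fps_nth q1 0 = 0" "fps_nth q2 0 = 0"
  shows "fps_nth (coprod_q q1 q2 F) 1 = first_order q1 q2 (fps_nth F 0) + coprod (fps_nth F 1)"
proof -
  let ?f = "\<lambda>n w. fps_nth (\<Prod>s\<in>#w. coprod_q_tree q1 q2 s) n"
  have "coprod (fps_nth F 1) = lin_extend (?f 0) (fps_nth F 1)"
    using coprod_q_nth_0[OF assms, of "fps_const (fps_nth F 1)"]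
    unfolding coprod_q_def fps_nth_h_extend by simp
  then show ?thesis
    unfolding first_order_eq coprod_q_def fps_nth_h_extend by simp
qed

text \<open>The order one coefficient of a product of two series is a Leibniz expression in their
  coefficients of orders zero and one, and the order zero part is \<open>coprod\<close>.\<close>

lemma first_order_derivation:
  fixes q1 q2 :: "'k::field fps"
  assumes "fps_nth q1 0 = 0" "fps_nth q2 0 = 0"
  shows "first_order q1 q2 \<in> derivations coprod"
proof -
  have "first_order q1 q2 (a * b) = first_order q1 q2 a * coprod b + coprod a * first_order q1 q2 b" for a b
  proof -
    have "first_order q1 q2 (a * b) = fps_nth (coprod_q q1 q2 (fps_const a) * coprod_q q1 q2 (fps_const b)) 1"
      unfolding first_order_def coprod_q_mult[symmetric] by simp
    then show ?thesis by (simp add: fps_mult_nth coprod_q_nth_0[OF assms] first_order_def)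
  qed
  moreover have "Vector_Spaces.linear scl scl (first_order q1 q2)"
    unfolding first_order_eq by (rule linear_lin_extend)
  ultimately show ?thesis unfolding derivations_def by blast
qed

text \<open>Tensors with two nonempty factors span an ideal, so the Leibniz rule carries this
  support condition from trees to forests.\<close>

lemma first_order_basis_keys:
  fixes q1 q2 :: "'k::field fps"
  assumes "fps_nth q1 0 = 0" "fps_nth q2 0 = 0"
    "\<And>s. s \<in># w \<Longrightarrow> \<forall>u\<in>Poly_Mapping.keys (first_order q1 q2 (tree s)). fst u \<noteq> {#} \<and> snd u \<noteq> {#}"
  shows "\<forall>u\<in>Poly_Mapping.keys (first_order q1 q2 (basis w)). fst u \<noteq> {#} \<and> snd u \<noteq> {#}"
  using assms(3)
proof (induction w)
  case empty
  then show ?case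
    using derivation_one[OF first_order_derivation[OF assms(1,2)] coprod_one]
    by (simp add: basis_zero flip: zero_multiset_def)
next
  case (add s w)
  define P :: "forest \<times> forest \<Rightarrow> bool" where "P u \<longleftrightarrow> fst u \<noteq> {#} \<and> snd u \<noteq> {#}" for u
  have P: "P u \<Longrightarrow> P (x + u)" for x u by (simp add: P_def)
  have s: "\<forall>u\<in>Poly_Mapping.keys (first_order q1 q2 (tree s)). P u"
    unfolding P_def by (rule add.prems) simp
  have w: "\<forall>u\<in>Poly_Mapping.keys (first_order q1 q2 (basis w)). P u"
    unfolding P_def by (rule add.IH, rule add.prems) simp
  have "first_order q1 q2 (basis (add_mset s w))
      = coprod (basis w) * first_order q1 q2 (tree s) + coprod (tree s) * first_order q1 q2 (basis w)"
    using derivationsD(2)[OF first_order_derivation[OF assms(1,2)], of "tree s" "basis w"]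
    by (simp only: basis_add_mset mult.commute)
  also have "\<forall>u\<in>Poly_Mapping.keys \<dots>. P u"
    by (rule keys_add_Ball; rule keys_mult_upward[where P = P], erule P, rule s w)
  finally show ?case unfolding P_def .
qed

text \<open>The recursion yields two terms: \<open>graft_1\<close> on the undeformed coproduct of
  \<open>w\<close>, which is the stated formula, and \<open>graft_0\<close> on the first order term
  of \<open>w\<close>, which vanishes.\<close>

lemma first_order_tree:
  fixes q1 q2 :: "'k::field fps"
  assumes q: "fps_nth q1 0 = 0" "fps_nth q2 0 = 0"
  shows "first_order q1 q2 (tree (Node w)) = scl (of_nat (count w dot))
     (scl (fps_nth q2 1) (tens (tree (Node (w - {#dot#}))) (tree dot))
      + scl (fps_nth q1 1) (tens (tree dot) (tree (Node (w - {#dot#})))))"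
proof -
  let ?P = "\<lambda>u :: forest \<times> forest. fst u \<noteq> {#} \<and> snd u \<noteq> {#}"
  let ?T = "\<lambda>w. scl (of_nat (count w dot))
     (scl (fps_nth q2 1) (tens (tree (Node (w - {#dot#}))) (tree dot))
      + scl (fps_nth q1 1) (tens (tree dot) (tree (Node (w - {#dot#})))))"
  have rec: "first_order q1 q2 (tree (Node w)) = ?T w + lin_extend graft_0 (first_order q1 q2 (basis w))" for w
    unfolding first_order_def coprod_q_tree_Node graft_step_nth[OF q]
    by (simp add: coprod_q_nth_0[OF q] lin_extend_graft_1)
  have eq: "first_order q1 q2 (tree (Node w)) = ?T w"
    if "\<And>s. s \<in># w \<Longrightarrow> \<forall>u\<in>Poly_Mapping.keys (first_order q1 q2 (tree s)). ?P u" for w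
  proof -
    \<comment> \<open>\<open>graft_0\<close> is zero unless one tensor factor is empty, which the
      support condition excludes.\<close>
    have "lin_extend graft_0 (first_order q1 q2 (basis w)) = 0"
      unfolding lin_extend_def using first_order_basis_keys[OF q, of w] that
      by (intro sum.neutral) (auto simp: graft_0_def scl_zero forest_deg_eq_0_iff)
    then show ?thesis by (simp add: rec)
  qed
  \<comment> \<open>The condition on the children gives the formula through \<open>eq\<close>, and
    the formula involves only tensors of two nonempty forests, so the condition propagates.\<close>
  have "\<forall>u\<in>Poly_Mapping.keys (first_order q1 q2 (tree s)). ?P u" for s
  proof (induction s)
    case (Node w)
    then have "first_order q1 q2 (tree (Node w)) = ?T w" by (intro eq)
    then show ?case
      by (auto simp: in_keys_iff lookup_scl lookup_add lookup_tens tree_def basis_def lookup_single when_def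
          split: if_splits)
  qed
  then show ?thesis by (intro eq)
qed

section \<open>Equivalence modulo the square of the deformation parameter\<close>

lemma cong_h2_iff: "cong_h2 F G \<longleftrightarrow> fps_nth F 0 = fps_nth G 0 \<and> fps_nth F 1 = fps_nth G 1"
proof
  assume "cong_h2 F G"
  then obtain H where "F - G = fps_X ^ 2 * H" by (auto simp: cong_h2_def)
  then have "fps_nth (F - G) n = 0" if "n < 2" for n using that by (simp add: fps_X_power_mult_nth)
  from this[of 0] this[of 1] show "fps_nth F 0 = fps_nth G 0 \<and> fps_nth F 1 = fps_nth G 1" by simp
next
  assume eq: "fps_nth F 0 = fps_nth G 0 \<and> fps_nth F 1 = fps_nth G 1"
  have "fps_nth (F - G) n = fps_nth (fps_X ^ 2 * fps_shift 2 (F - G)) n" for n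
  proof (cases "n < 2")
    case True
    then have "n = 0 \<or> n = 1" by auto
    then show ?thesis using eq by (auto simp: fps_X_power_mult_nth)
  next
    case False
    then obtain m where "n = 2 + m" by (metis le_Suc_ex not_less)
    then show ?thesis by (simp add: fps_X_power_mult_nth add.commute)
  qed
  then have "F - G = fps_X ^ 2 * fps_shift 2 (F - G)" by (rule fps_ext)
  then show "cong_h2 F G" unfolding cong_h2_def by (rule dvdI)
qed

lemma id_plus_h_nth:
  "fps_nth (id_plus_h \<psi> F) 0 = fps_nth F 0" "fps_nth (id_plus_h \<psi> F) (Suc 0) = fps_nth F 1 + \<psi> (fps_nth F 0)"
  by (simp_all add: id_plus_h_def fps_X_mult_nth)

text \<open>The order zero coefficients always agree. At order one, \<open>coprod\<close> of the
  linear coefficient of \<open>F\<close> cancels, and the rest is the differential of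
  \<open>\<psi>\<close> evaluated at the constant coefficient.\<close>

lemma equivalent_mod_h2_iff:
  fixes q1 q2 q1' q2' :: "'k::field fps"
  assumes q: "fps_nth q1 0 = 0" "fps_nth q2 0 = 0" and q': "fps_nth q1' 0 = 0" "fps_nth q2' 0 = 0"
  shows "equivalent_mod_h2 (coprod_q q1 q2) (coprod_q q1' q2') \<longleftrightarrow>
    (\<exists>\<psi>\<in>Der0_1. \<forall>a. first_order q1' q2' a - first_order q1 q2 a = hochschild_d \<psi> a)"
proof -
  have "(\<forall>F. cong_h2 (coprod_q q1' q2' (id_plus_h \<psi> F))
        (h_tens_map (id_plus_h \<psi>) (id_plus_h \<psi>) (coprod_q q1 q2 F))) \<longleftrightarrow>
      (\<forall>a. first_order q1' q2' a - first_order q1 q2 a = hochschild_d \<psi> a)" (is "?L \<longleftrightarrow> ?R")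
    if \<psi>: "\<psi> \<in> Der0_1" for \<psi> :: "'k forest_alg \<Rightarrow> 'k forest_alg"
  proof -
    define g where "g z = (case z of (x, y) \<Rightarrow>
      h_tens (id_plus_h \<psi> (fps_const (basis x))) (id_plus_h \<psi> (fps_const (basis y))))" for z
    have g0: "lin_extend (\<lambda>z. fps_nth (g z) 0) p = p" for p
      by (rule linear_eqI[OF linear_lin_extend linearI])
        (auto simp: g_def h_tens_def id_plus_h_nth lin_extend_basis tens_basis)
    have "fps_nth (g z) (Suc 0) = (case z of (x, y) \<Rightarrow> tens (\<psi> (basis x)) (id (basis y)))
        + (case z of (x, y) \<Rightarrow> tens (id (basis x)) (\<psi> (basis y)))" for z
      by (cases z) (simp add: g_def h_tens_def id_plus_h_nth add.commute)
    then have g1: "lin_extend (\<lambda>z. fps_nth (g z) (Suc 0)) p = tens_map \<psi> id p + tens_map id \<psi> p" for p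
      by (simp add: lin_extend_fun_add tens_map_def)
    have h: "h_tens_map (id_plus_h \<psi>) (id_plus_h \<psi>) = h_extend g"
      by (simp add: h_tens_map_def g_def[abs_def])
    have n: "fps_nth (h_extend g P) 0 = fps_nth P 0"
      "fps_nth (h_extend g P) 1 = tens_map \<psi> id (fps_nth P 0) + tens_map id \<psi> (fps_nth P 0) + fps_nth P 1" for P
      by (simp_all add: fps_nth_h_extend g0 g1)
    have "cong_h2 (coprod_q q1' q2' (id_plus_h \<psi> F)) (h_tens_map (id_plus_h \<psi>) (id_plus_h \<psi>) (coprod_q q1 q2 F))
        \<longleftrightarrow> first_order q1' q2' (fps_nth F 0) - first_order q1 q2 (fps_nth F 0) = hochschild_d \<psi> (fps_nth F 0)" for F
      unfolding cong_h2_iff h n coprod_q_nth_0[OF q] coprod_q_nth_0[OF q'] coprod_q_nth_1[OF q] coprod_q_nth_1[OF q']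
      by (auto simp: id_plus_h_nth linearD[OF linear_coprod] hochschild_d_def algebra_simps)
    \<comment> \<open>Constant series realise every \<open>a\<close> as a constant
      coefficient.\<close>
    then show ?thesis by (metis fps_nth_fps_const)
  qed
  then show ?thesis unfolding equivalent_mod_h2_def by (intro bex_cong) auto
qed

section \<open>Comparison of two deformations\<close>

lemma coprod_bar_tree_mult:
  fixes s t :: rtree
  shows "coprod_bar (tree s * tree t :: 'k::field forest_alg) = tens (tree s) (tree t) + tens (tree t) (tree s)"
  by (simp add: coprod_bar_def coprod_mult coprod_tree distrib_left distrib_right tens_mult mult.commute)

lemma equivalent_mod_h2_coprod_q_iff:
  fixes q1 q2 q1' q2' :: "'k::field_char_0 fps"
  assumes q: "fps_nth q1 0 = 0" "fps_nth q2 0 = 0" and q': "fps_nth q1' 0 = 0" "fps_nth q2' 0 = 0"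
  shows "equivalent_mod_h2 (coprod_q q1 q2) (coprod_q q1' q2') \<longleftrightarrow>
    fps_nth q1 1 - fps_nth q2 1 = fps_nth q1' 1 - fps_nth q2' 1"
proof -
  define e1 where "e1 = fps_nth q1' 1 - fps_nth q1 1"
  define e2 where "e2 = fps_nth q2' 1 - fps_nth q2 1"
  define \<delta> where "\<delta> a = first_order q1' q2' a - first_order q1 q2 a" for a
  have tree: "\<delta> (tree (Node w)) = scl (of_nat (count w dot))
     (scl e2 (tens (tree (Node (w - {#dot#}))) (tree dot)) + scl e1 (tens (tree dot) (tree (Node (w - {#dot#})))))" for w
    unfolding \<delta>_def first_order_tree[OF q] first_order_tree[OF q'] e1_def e2_def
    by (simp add: scl_def single_diff algebra_simps)
  have "equivalent_mod_h2 (coprod_q q1 q2) (coprod_q q1' q2') \<longleftrightarrow> (\<exists>\<psi>\<in>Der0_1. \<forall>a. \<delta> a = hochschild_d \<psi> a)"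
    by (simp add: equivalent_mod_h2_iff[OF q q'] \<delta>_def)
  also have "\<dots> \<longleftrightarrow> e1 = e2"
  proof
    assume "\<exists>\<psi>\<in>Der0_1. \<forall>a. \<delta> a = hochschild_d \<psi> a"
    then obtain \<psi> where \<psi>: "\<psi> \<in> Der0_1" "\<And>a. \<delta> a = hochschild_d \<psi> a" by auto
    \<comment> \<open>With two leaves at the root, deleting one leaves the chain on two vertices,
      which differs from a leaf. The two tensors are then distinct, with coefficients
      \<open>2 * e2\<close> and \<open>2 * e1\<close>, and 2 can be cancelled in characteristic
      zero.\<close>
    let ?t = "Node {#dot, dot#}" and ?u = "{#Node {#dot#}#}"
    have "Poly_Mapping.lookup (\<delta> (tree ?t)) (x, y) = Poly_Mapping.lookup (\<delta> (tree ?t)) (y, x)" for x y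
      by (simp add: \<psi>(2) hochschild_d_tree[OF \<psi>(1)] coprod_bar_def lookup_minus lookup_add
          lookup_tens lookup_coprod_swap[of _ x y] mult.commute add.commute lookup_uminus)
    from this[of ?u "{#dot#}", unfolded tree] show "e1 = e2"
      by (simp add: lookup_scl lookup_add lookup_tens tree_def basis_def lookup_single)
  next
    assume e: "e1 = e2"
    \<comment> \<open>\<open>coprod_bar_tree_mult\<close> turns the product of two trees into both
      tensors with equal coefficients; the sign compensates for
      \<open>hochschild_d_tree\<close>.\<close>
    define D where "D s = (case s of Node w \<Rightarrow>
      scl (- (of_nat (count w dot) * e1)) (tree dot * tree (Node (w - {#dot#})) :: 'k forest_alg))" for s
    have "homogeneous forest_deg (vertices s) (D s)" for s
    proof (cases s)
      case (Node w)
      show ?thesis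
      proof (cases "dot \<in># w")
        case True
        then obtain v where "w = add_mset dot v" by (metis insert_DiffM)
        then show ?thesis
          using homogeneous_mult[OF forest_deg_simps(3) homogeneous_tree homogeneous_tree, of dot "Node v"]
          by (auto simp: D_def Node intro!: homogeneous_scl)
      next
        \<comment> \<open>Without a leaf child nothing is deleted and the product has degree one too
          many, but its coefficient is zero.\<close>
        case False
        then show ?thesis by (simp add: D_def Node not_in_iff scl_zero homogeneous_simps)
      qed
    qed
    then have \<psi>: "tree_derivation D \<in> Der0_1" by (rule tree_derivation_Der0_1)
    have "\<delta> = hochschild_d (tree_derivation D)"
    proof (rule derivation_eqI)
      show "hochschild_d (tree_derivation D) \<in> derivations coprod"
        using hochschild_d_Der0_2[OF \<psi>] by (auto simp: Der0_2_def)
      show "\<delta> \<in> derivations coprod"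
        using derivationsD[OF first_order_derivation[OF q]] derivationsD[OF first_order_derivation[OF q']]
        unfolding derivations_def \<delta>_def
        by (auto simp: linearD(1,2)[OF derivationsD(1)[OF first_order_derivation[OF q]]]
            linearD(1,2)[OF derivationsD(1)[OF first_order_derivation[OF q']]] scl_minus algebra_simps
            intro!: linearI)
      show "\<delta> (tree s) = hochschild_d (tree_derivation D) (tree s)" for s
        by (cases s) (simp add: tree hochschild_d_tree[OF \<psi>] tree_derivation_tree D_def
            linearD[OF linear_coprod_bar] coprod_bar_tree_mult scl_minus scl_add scl_scl e)
    qed (rule coprod_one)
    then show "\<exists>\<psi>\<in>Der0_1. \<forall>a. \<delta> a = hochschild_d \<psi> a" using \<psi> by auto
  qed
  also have "\<dots> \<longleftrightarrow> fps_nth q1 1 - fps_nth q2 1 = fps_nth q1' 1 - fps_nth q2' 1"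
    by (auto simp: e1_def e2_def algebra_simps)
  finally show ?thesis .
qed

theorem proposition6p1:
  shows "(boundaries0_2 :: ('k::field_char_0 forest_alg \<Rightarrow> 'k forest_alg2) set) =
      {\<phi> \<in> Der0_2. \<exists>c :: rtree \<Rightarrow> forest \<Rightarrow> 'k. \<forall>s.
         \<phi> (tree s) = (\<Sum>w | forest_deg w = vertices s. scl (c s w) (coprod_bar (basis w)))}
    \<and> (\<forall>(q1 :: 'k fps) (q2 :: 'k fps) (q1' :: 'k fps) (q2' :: 'k fps)
          (c1 :: 'k) (c2 :: 'k) (d1 :: 'k) (d2 :: 'k).
         fps_X dvd q1 \<and> fps_X dvd q2 \<and> fps_X dvd q1' \<and> fps_X dvd q2' \<and>
         cong_h2 q1 (fps_const c1 * fps_X) \<and> cong_h2 q2 (fps_const c2 * fps_X) \<and>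
         cong_h2 q1' (fps_const d1 * fps_X) \<and> cong_h2 q2' (fps_const d2 * fps_X)
         \<longrightarrow> (equivalent_mod_h2 (coprod_q q1 q2) (coprod_q q1' q2') \<longleftrightarrow> c1 - c2 = d1 - d2))"
proof (intro conjI allI impI)
  fix q1 q2 q1' q2' :: "'k fps" and c1 c2 d1 d2 :: 'k
  assume "fps_X dvd q1 \<and> fps_X dvd q2 \<and> fps_X dvd q1' \<and> fps_X dvd q2' \<and>
         cong_h2 q1 (fps_const c1 * fps_X) \<and> cong_h2 q2 (fps_const c2 * fps_X) \<and>
         cong_h2 q1' (fps_const d1 * fps_X) \<and> cong_h2 q2' (fps_const d2 * fps_X)"
  then show "equivalent_mod_h2 (coprod_q q1 q2) (coprod_q q1' q2') \<longleftrightarrow> c1 - c2 = d1 - d2"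
    by (simp add: cong_h2_iff equivalent_mod_h2_coprod_q_iff)
qed (rule boundaries0_2_eq)

end
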